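(* Let $A$, $B$ and $B'$ be matrices in $\mathbb{C}^{d\times d}$. Then the Horn matrix function $G_1(A,B,B';x,y)$ satisfies the following infinite summation formulae for $|t|<1$: (1) $(1-t)^{-A}\,G_1\!\left(A,B,B';\frac{x}{1-t},\frac{y}{1-t}\right)=\sum_{n=0}^{\infty}\frac{(A)_n}{n!}\,G_1(A+nI,B,B';x,y)\,t^n$; (2) if $BB'=B'B$, $G_1\!\left(A,B,B';x(1-t),\frac{y}{1-t}\right)(1-t)^{-B}=\sum_{n=0}^{\infty}G_1(A,B+nI,B';x,y)\,\frac{(B)_n}{n!}\,t^n$; (3) $G_1\!\left(A,B,B';\frac{x}{1-t},y(1-t)\right)(1-t)^{-B'}=\sum_{n=0}^{\infty}G_1(A,B,B'+nI;x,y)\,\frac{(B')_n}{n!}\,t^n$.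
   Context: $G_1(A,B,B';x,y)=\sum_{m,n=0}^{\infty}(A)_{m+n}(B)_{n-m}(B')_{m-n}\frac{x^m y^n}{m!\,n!}$. Matrix Pochhammer symbol: for $M\in\mathbb{C}^{d\times d}$, $(M)_0=I$, $(M)_n=M(M+I)\cdots(M+(n-1)I)$ for $n\ge1$, and $(M)_{-n}=(-1)^n(I-M)_n^{-1}$. For $|t|<1$, $(1-t)^{-M}=\sum_{n\ge0}\frac{(M)_n}{n!}t^n$.
   Formalization: All Pochhammer symbols are assumed defined and G_1's arguments lie in |x|+|y|<1; since the right-hand series can diverge for some |t|<1, equality is claimed where it converges, and convergence is proved when the scaled arguments stay in the region for all |s|≤|t|. *)

theory Defs
  imports "HOL-Analysis.Analysis"
begin

(* Square complex matrices are elements of complex^'d^'d with product "**" and identity "mat 1";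
   "mat c" is c times the identity.  Mind that "*", "^" and "1" are componentwise on this type. *)

definition cscale :: "complex \<Rightarrow> complex^'d^'d \<Rightarrow> complex^'d^'d" where
  "cscale c M = (\<chi> i j. c * M $ i $ j)"

primrec mpoch_nat :: "complex^'d^'d \<Rightarrow> nat \<Rightarrow> complex^'d^'d" where
  "mpoch_nat M 0 = mat 1"
| "mpoch_nat M (Suc n) = mpoch_nat M n ** (M + mat (of_nat n))"

definition mpoch :: "complex^'d^'d \<Rightarrow> int \<Rightarrow> complex^'d^'d" where
  "mpoch M k =
     (if 0 \<le> k then mpoch_nat M (nat k)
      else cscale ((- 1) ^ nat (- k)) (matrix_inv (mpoch_nat (mat 1 - M) (nat (- k)))))"

(* The symbols with negative index involve inverses, which need not exist; this says that all of
   them do. *)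
definition mpoch_defined :: "complex^'d^'d \<Rightarrow> bool" where
  "mpoch_defined M \<longleftrightarrow> (\<forall>n. invertible (mpoch_nat (mat 1 - M) n))"

(* (1 - t)^(-M), for norm t < 1 *)
definition one_minus_mpow_neg :: "complex \<Rightarrow> complex^'d^'d \<Rightarrow> complex^'d^'d" where
  "one_minus_mpow_neg t M = (\<Sum>n. cscale (t ^ n / fact n) (mpoch_nat M n))"

definition Horn_G1 ::
  "complex^'d^'d \<Rightarrow> complex^'d^'d \<Rightarrow> complex^'d^'d \<Rightarrow> complex \<Rightarrow> complex \<Rightarrow> complex^'d^'d" where
  "Horn_G1 A B B' x y =
     (\<Sum>\<^sub>\<infinity>(m, n)\<in>(UNIV :: (nat \<times> nat) set).
        cscale (x ^ m * y ^ n / (fact m * fact n))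
          (mpoch_nat A (m + n) ** mpoch B (int n - int m) ** mpoch B' (int m - int n)))"

(* Region of (absolute) convergence of the double series G1: in this region it converges for all
   A, B, B' for which its terms are defined, and for generic parameters it diverges when
   norm x + norm y > 1. *)
definition Horn_G1_region :: "complex \<Rightarrow> complex \<Rightarrow> bool" where
  "Horn_G1_region x y \<longleftrightarrow> norm x + norm y < 1"

end

theory Submission
  imports Defs "HOL-Complex_Analysis.Conformal_Mappings"
begin

text \<open>
  Write \<open>P s M\<close> for the matrix power \<open>(1 - s)\<^sup>-\<^sup>M\<close>.  All three formulae rest on one identity between
  scalar power series with matrix coefficients: \<open>P s (M + l) = (1 - s)\<^sup>-\<^sup>l P s M\<close> for every integer
  \<open>l\<close> (\<open>one_minus_mpow_neg_shift\<close>).  Scaling the arguments of \<open>G\<^sub>1\<close> multiplies the term with index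
  \<open>(m, n)\<close> by \<open>(1 - s)\<^sup>-\<^sup>l\<close>, where \<open>l = m + n\<close> in the first formula and \<open>l = m - n\<close> in the third, so the
  outer factor \<open>P s M\<close> turns into \<open>P s (M + l)\<close> inside the sum.  Expanding it in powers of \<open>s\<close> and
  interchanging the sum over \<open>(m, n)\<close> with the sum over \<open>k\<close> gives the coefficients on the right-hand
  side, because \<open>(M)\<^sub>l (M + l)\<^sub>k = (M + k)\<^sub>l (M)\<^sub>k\<close> (\<open>mpoch_nat_add\<close>, \<open>mpoch_shift_exchange\<close>).  The second formula
  is the third one with \<open>B\<close>, \<open>B'\<close> and \<open>x\<close>, \<open>y\<close> exchanged; commutativity of \<open>B\<close> and \<open>B'\<close> makes this a
  symmetry of \<open>G\<^sub>1\<close> (\<open>Horn_G1_swap\<close>).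

  The interchange is justified by absolute convergence (\<open>binomial_series_interchange\<close>), but only for small
  \<open>s\<close>.  The estimates behind it say that \<open>(A)\<^sub>N / N!\<close> and \<open>(B)\<^sub>-\<^sub>l (B')\<^sub>l\<close> grow more slowly than any exponential,
  so the double series is dominated by a multiple of \<open>\<Sum> (m + n choose m) X\<^sup>m Y\<^sup>n\<close> with \<open>X + Y < 1\<close>
  (\<open>horn_majorant_summable\<close>).

  The passage from small \<open>s\<close> to \<open>t\<close> uses analytic continuation (\<open>power_series_on_horn_lune\<close>).  The left-hand
  side is holomorphic on the set of all \<open>s\<close> in the unit disc for which the scaled arguments lie in the
  region of convergence.  If the series on the right converges at \<open>t\<close>, it is holomorphic for \<open>norm s < norm t\<close>;
  both sides agree on the part of the former set inside this disc, since that part is connected, and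
  Abel's limit theorem along the radius to \<open>t\<close> settles the boundary point \<open>t\<close> itself.  Connectedness
  matters: the segment from \<open>0\<close> to \<open>t\<close> may leave the set.  If the whole closed disc of radius \<open>norm t\<close>
  lies in the set, convergence at \<open>t\<close> is Taylor's theorem.
\<close>

section \<open>Scalar multiples and inverses of complex matrices\<close>

lemma cscale_eq_mat_mult: "cscale c M = mat c ** M"
  by (simp add: cscale_def matrix_matrix_mult_def mat_def vec_eq_iff if_distrib if_distribR
      cong: if_cong)

lemma mat_of_complex_commute: "mat c ** M = M ** mat (c::complex)"
  by (simp add: matrix_matrix_mult_def mat_def vec_eq_iff if_distrib if_distribR mult.commute
      cong: if_cong)

lemma cscale_mult_left: "cscale c M ** N = cscale c (M ** N)"
  by (simp add: cscale_eq_mat_mult matrix_mul_assoc)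

lemma cscale_mult_right: "M ** cscale c N = cscale c (M ** N)"
  by (metis cscale_eq_mat_mult mat_of_complex_commute matrix_mul_assoc)

lemma cscale_cscale [simp]: "cscale a (cscale b M) = cscale (a * b) M"
  by (simp add: cscale_def vec_eq_iff)

lemma cscale_1 [simp]: "cscale 1 M = M"
  by (simp add: cscale_def vec_eq_iff)

lemma cscale_nth [simp]: "cscale c M $ i $ j = c * M $ i $ j"
  by (simp add: cscale_def)

lemma mat_add: "mat a + mat b = (mat (a + b) :: complex^'d^'d)"
  by (simp add: mat_def vec_eq_iff)

lemma cscale_diff_right: "cscale a (M - N) = cscale a M - cscale a N"
  by (simp add: vec_eq_iff algebra_simps)

lemma matrix_mult_add_left: "(M + N) ** P = M ** P + N ** (P :: complex^'d^'d)"
  by (simp add: matrix_matrix_mult_def vec_eq_iff sum.distrib algebra_simps)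

lemma invertible_matrix_inv:
  fixes M :: "complex^'d^'d"
  assumes "invertible M"
  shows "M ** matrix_inv M = mat 1" "matrix_inv M ** M = mat 1"
  using someI_ex[OF assms[unfolded invertible_def]] by (auto simp: matrix_inv_def)

lemma matrix_inv_unique:
  fixes X Y :: "complex^'d^'d"
  assumes "X ** Y = mat 1"
  shows "matrix_inv X = Y"
proof -
  have "Y ** X = mat 1" using assms by (simp add: matrix_left_right_inverse)
  moreover from this assms have "X ** matrix_inv X = mat 1"
    by (intro invertible_matrix_inv) (auto simp: invertible_def)
  ultimately show ?thesis by (metis matrix_mul_assoc matrix_mul_lid matrix_mul_rid)
qed

lemma bounded_linear_matrix_mult_left: "bounded_linear (\<lambda>X::complex^'d^'d. P ** X)"
proof -
  have "linear (\<lambda>X::complex^'d^'d. P ** X)"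
    by (rule linearI) (simp_all add: matrix_add_ldistrib matrix_matrix_mult_def vec_eq_iff
        scaleR_sum_right sum.distrib algebra_simps)
  thus ?thesis by (simp add: linear_conv_bounded_linear)
qed

lemma bounded_linear_matrix_mult_right: "bounded_linear (\<lambda>X::complex^'d^'d. X ** P)"
proof -
  have "linear (\<lambda>X::complex^'d^'d. X ** P)"
    by (rule linearI) (simp_all add: matrix_matrix_mult_def vec_eq_iff
        scaleR_sum_right sum.distrib algebra_simps)
  thus ?thesis by (simp add: linear_conv_bounded_linear)
qed

lemma bounded_linear_cscale: "bounded_linear (cscale c)"
  using bounded_linear_matrix_mult_left[of "mat c"] by (simp add: cscale_eq_mat_mult[abs_def])

lemma bounded_linear_entry: "bounded_linear (\<lambda>X::complex^'d^'d. X $ i $ j)"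
  by (rule bounded_linear_compose[OF bounded_linear_vec_nth bounded_linear_vec_nth])

section \<open>The operator norm\<close>

text \<open>
  The norm of the type of matrices is the Frobenius norm, for which the identity has norm \<open>\<surd>d\<close>; products
  of \<open>n\<close> factors \<open>M + j\<close> would then pick up a factor of exponential size.  The operator norm avoids this.
\<close>
definition opnorm :: "complex^'d^'d \<Rightarrow> real" where
  "opnorm M = onorm ((*v) M)"

lemma opnorm_nonneg [simp]: "0 \<le> opnorm M"
  by (simp add: opnorm_def onorm_pos_le)

lemma opnorm_mult: "opnorm (M ** N) \<le> opnorm M * opnorm N"
proof -
  have "(*v) (M ** N) = (*v) M \<circ> (*v) N"
    by (simp add: fun_eq_iff matrix_vector_mul_assoc)
  thus ?thesis unfolding opnorm_def by (metis onorm_compose matrix_vector_mul_bounded_linear)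
qed

lemma opnorm_add: "opnorm (M + N) \<le> opnorm M + opnorm N"
proof -
  have "(*v) (M + N) = (\<lambda>v. M *v v + N *v v)"
    by (simp add: fun_eq_iff matrix_vector_mult_add_rdistrib)
  thus ?thesis unfolding opnorm_def by (simp add: onorm_triangle)
qed

lemma norm_vector_scalar_mult: "norm (c *s v) = norm c * norm (v :: complex^'d)"
  by (simp add: norm_vec_def vector_scalar_mult_def norm_mult L2_set_right_distrib)

lemma opnorm_cscale: "opnorm (cscale c M) \<le> norm c * opnorm M"
  unfolding opnorm_def
proof (rule onorm_le)
  fix v :: "complex^'a"
  have "cscale c M *v v = c *s (M *v v)"
    by (simp add: vec_eq_iff matrix_vector_mult_def sum_distrib_left mult.assoc)
  hence "norm (cscale c M *v v) = norm c * norm (M *v v)"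
    by (simp add: norm_vector_scalar_mult)
  also have "\<dots> \<le> norm c * (onorm ((*v) M) * norm v)"
    by (intro mult_left_mono onorm) auto
  finally show "norm (cscale c M *v v) \<le> norm c * onorm ((*v) M) * norm v"
    by (simp add: mult.assoc)
qed

lemma opnorm_one: "opnorm (mat 1) \<le> 1"
  unfolding opnorm_def by (rule onorm_le) simp

lemma opnorm_mat: "opnorm (mat c :: complex^'d^'d) \<le> norm c"
proof -
  have "opnorm (cscale c (mat 1 :: complex^'d^'d)) \<le> norm c * opnorm (mat 1 :: complex^'d^'d)" by (rule opnorm_cscale)
  also have "\<dots> \<le> norm c * 1" by (intro mult_left_mono opnorm_one) auto
  finally show ?thesis by (simp add: cscale_eq_mat_mult)
qed

lemma entry_le_opnorm: "norm (M $ i $ j) \<le> opnorm M"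
proof -
  have "M $ i $ j = (M *v axis j 1) $ i"
    by (simp add: matrix_vector_mult_def axis_def if_distrib cong: if_cong)
  also have "norm \<dots> \<le> norm (M *v axis j 1)" by (rule Finite_Cartesian_Product.norm_nth_le)
  also have "\<dots> \<le> onorm ((*v) M) * norm (axis j (1::complex))" by (intro onorm) auto
  finally show ?thesis by (simp add: opnorm_def)
qed

lemma norm_le_opnorm: "norm (M :: complex^'d^'d) \<le> real (CARD('d))^2 * opnorm M"
proof -
  have "norm M \<le> (\<Sum>i\<in>UNIV. norm (M $ i))"
    unfolding norm_vec_def by (rule L2_set_le_sum) simp
  also have "\<dots> \<le> (\<Sum>i\<in>(UNIV::'d set). \<Sum>j\<in>(UNIV::'d set). opnorm M)"
  proof (rule sum_mono)
    fix i
    have "norm (M $ i) \<le> (\<Sum>j\<in>UNIV. norm (M $ i $ j))"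
      unfolding norm_vec_def[of "M $ i"] by (rule L2_set_le_sum) simp
    also have "\<dots> \<le> (\<Sum>j\<in>(UNIV::'d set). opnorm M)" by (intro sum_mono entry_le_opnorm)
    finally show "norm (M $ i) \<le> (\<Sum>j\<in>(UNIV::'d set). opnorm M)" .
  qed
  finally show ?thesis by (simp add: power2_eq_square mult.assoc)
qed

section \<open>Algebra of the matrix Pochhammer symbol\<close>

lemma mpoch_of_nat [simp]: "mpoch M (int n) = mpoch_nat M n"
  by (simp add: mpoch_def)

lemma mpoch_nat_1 [simp]: "mpoch_nat M (Suc 0) = M"
  by (simp add: mat_def vec_eq_iff matrix_matrix_mult_def if_distrib if_distribR cong: if_cong)

lemma mpoch_nat_add: "mpoch_nat M (m + n) = mpoch_nat M m ** mpoch_nat (M + mat (of_nat m)) n"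
  by (induction n) (simp_all add: matrix_mul_assoc mat_add add.assoc of_nat_add)

lemma commute_mpoch_nat:
  assumes "X ** M = M ** X"
  shows "X ** mpoch_nat M n = mpoch_nat M n ** X"
proof (induction n)
  case (Suc n)
  have "X ** (M + mat (of_nat n)) = (M + mat (of_nat n)) ** X"
    by (simp add: matrix_add_ldistrib matrix_mult_add_left assms mat_of_complex_commute)
  with Suc show ?case by (metis mpoch_nat.simps(2) matrix_mul_assoc)
qed simp

lemma commute_shift: "X ** M = M ** X \<Longrightarrow> X ** (M + mat c) = (M + mat c) ** (X :: complex^'d^'d)"
  by (simp add: matrix_add_ldistrib matrix_mult_add_left mat_of_complex_commute)

text \<open>
  Both factors are polynomials in \<open>M\<close>.
\<close>
lemma mpoch_nat_shift_commute:
  "mpoch_nat (M + mat a) m ** mpoch_nat (M + mat b) n = mpoch_nat (M + mat b) n ** mpoch_nat (M + mat a) m"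
proof -
  have "(M + mat b) ** (M + mat a) = (M + mat a) ** (M + mat b)"
    by (intro commute_shift) (simp add: commute_shift[symmetric])
  hence "(M + mat b) ** mpoch_nat (M + mat a) m = mpoch_nat (M + mat a) m ** (M + mat b)"
    by (rule commute_mpoch_nat)
  thus ?thesis by (metis commute_mpoch_nat)
qed

lemma matrix_inv_commute:
  fixes X Y :: "complex^'d^'d"
  assumes "invertible Y" "X ** Y = Y ** X"
  shows "X ** matrix_inv Y = matrix_inv Y ** X"
proof -
  have "X ** matrix_inv Y = matrix_inv Y ** Y ** X ** matrix_inv Y"
    using assms(1) by (simp add: invertible_matrix_inv)
  also have "\<dots> = matrix_inv Y ** X ** (Y ** matrix_inv Y)"
    using assms(2) by (metis matrix_mul_assoc)
  finally show ?thesis using assms(1) by (simp add: invertible_matrix_inv)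
qed

lemma mpoch_nat_Suc_left: "mpoch_nat M (Suc n) = M ** mpoch_nat (M + mat 1) n"
  using mpoch_nat_add[of M 1 n] by (simp del: mpoch_nat.simps)

text \<open>
  The factors \<open>1 - M, \<dots>, p - M\<close> are, up to sign and in reverse order, \<open>M - p, \<dots>, M - 1\<close>.
\<close>
lemma mpoch_nat_reflect:
  "mpoch_nat (mat 1 - M) p = cscale ((-1) ^ p) (mpoch_nat (M - mat (of_nat p)) p)"
proof (induction p)
  case (Suc p)
  have a: "M - mat (of_nat (Suc p)) + mat 1 = M - mat (of_nat p)"
    by (simp add: vec_eq_iff mat_def)
  have b: "mat 1 - M + mat (of_nat p) = cscale (-1) (M - mat (of_nat (Suc p)))"
    by (simp add: vec_eq_iff mat_def)
  have c: "(M - mat (of_nat (Suc p))) ** mpoch_nat (M - mat (of_nat p)) p =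
           mpoch_nat (M - mat (of_nat p)) p ** (M - mat (of_nat (Suc p)))"
  proof (rule commute_mpoch_nat)
    have "M - mat (of_nat p) = (M - mat (of_nat (Suc p))) + mat 1" by (simp only: a)
    thus "(M - mat (of_nat (Suc p))) ** (M - mat (of_nat p)) =
        (M - mat (of_nat p)) ** (M - mat (of_nat (Suc p)))"
      by (metis commute_shift)
  qed
  have "mpoch_nat (mat 1 - M) (Suc p) =
      cscale ((-1) ^ Suc p) (mpoch_nat (M - mat (of_nat p)) p ** (M - mat (of_nat (Suc p))))"
    by (simp only: mpoch_nat.simps b Suc cscale_mult_left cscale_mult_right cscale_cscale)
       simp
  also have "mpoch_nat (M - mat (of_nat p)) p ** (M - mat (of_nat (Suc p)))
     = mpoch_nat (M - mat (of_nat (Suc p))) (Suc p)"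
    unfolding mpoch_nat_Suc_left a c ..
  finally show ?case .
qed simp

lemma invertible_cscale: "c \<noteq> 0 \<Longrightarrow> invertible M \<Longrightarrow> invertible (cscale c M)"
  unfolding invertible_def
  by (metis cscale_1 cscale_cscale cscale_mult_left cscale_mult_right left_inverse right_inverse)

text \<open>
  In this form the symbol with negative index inverts a product of factors shifted from \<open>M\<close> downwards, so it
  combines with the addition law \<open>mpoch_nat_add\<close>.
\<close>
lemma mpoch_neg:
  assumes "mpoch_defined M"
  shows "invertible (mpoch_nat (M - mat (of_nat p)) p)"
        "mpoch M (- int p) = matrix_inv (mpoch_nat (M - mat (of_nat p)) p)"
proof -
  let ?Y = "mpoch_nat (mat 1 - M) p"
  let ?Z = "mpoch_nat (M - mat (of_nat p)) p"
  have inv: "invertible ?Y" using assms by (simp add: mpoch_defined_def)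
  have Z: "?Z = cscale ((-1) ^ p) ?Y"
    by (simp add: mpoch_nat_reflect flip: power_mult_distrib)
  show "invertible ?Z" unfolding Z by (intro invertible_cscale inv) auto
  have "mpoch M (- int p) = cscale ((-1)^p) (matrix_inv ?Y)"
    by (cases "p = 0") (auto simp: mpoch_def matrix_inv_unique)
  also have "\<dots> = matrix_inv ?Z"
    unfolding Z using inv
    by (intro matrix_inv_unique[symmetric])
       (simp add: cscale_mult_left cscale_mult_right invertible_matrix_inv flip: power_mult_distrib)
  finally show "mpoch M (- int p) = matrix_inv ?Z" .
qed

text \<open>
  Both sides are the symbol with index \<open>l + k\<close> whenever that makes sense.  For \<open>l = -p\<close> and \<open>N = M - p\<close> the claim
  reads \<open>(N)\<^sub>p\<^sup>-\<^sup>1 (N)\<^sub>k = (N + k)\<^sub>p\<^sup>-\<^sup>1 (N + p)\<^sub>k\<close>; cleared of inverses, both sides become \<open>(N)\<^sub>p\<^sub>+\<^sub>k\<close>.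
\<close>
lemma mpoch_shift_exchange:
  fixes M :: "complex^'d^'d"
  assumes "mpoch_defined M" "mpoch_defined (M + mat (of_nat k))"
  shows "mpoch M l ** mpoch_nat (M + mat (of_int l)) k = mpoch (M + mat (of_nat k)) l ** mpoch_nat M k"
proof (cases "l \<ge> 0")
  case True
  then obtain n where n: "l = int n" by (metis nonneg_eq_int)
  have "mpoch_nat M n ** mpoch_nat (M + mat (of_nat n)) k = mpoch_nat M k ** mpoch_nat (M + mat (of_nat k)) n"
    by (metis mpoch_nat_add add.commute)
  also have "\<dots> = mpoch_nat (M + mat (of_nat k)) n ** mpoch_nat M k"
    using mpoch_nat_shift_commute[of M 0 k "of_nat k" n] by (simp add: mat_def flip: zero_vec_def)
  finally show ?thesis by (simp add: n)
next
  case False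
  then obtain p where p: "l = - int p" by (metis int_cases2 of_nat_0_le_iff)
  define N where "N = M - mat (of_nat p)"
  have e: "M = N + mat (of_nat p)" "M + mat (of_int l) = N" "M - mat (of_nat p) = N"
       "M + mat (of_nat k) - mat (of_nat p) = N + mat (of_nat k)"
    by (simp_all add: N_def p vec_eq_iff mat_def)
  let ?X = "mpoch_nat N p" and ?Y = "mpoch_nat (N + mat (of_nat k)) p"
  have X: "invertible ?X" "mpoch M l = matrix_inv ?X"
    using mpoch_neg[OF assms(1), of p] by (simp_all add: p e(3))
  have Y: "invertible ?Y" "mpoch (M + mat (of_nat k)) l = matrix_inv ?Y"
    using mpoch_neg[OF assms(2), of p] by (simp_all add: p e(4))
  have XY: "?X ** ?Y = ?Y ** ?X"
    using mpoch_nat_shift_commute[of N 0 p "of_nat k" p] by (simp add: mat_def flip: zero_vec_def)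
  have YN: "?Y ** mpoch_nat N k = ?X ** mpoch_nat M k"
  proof -
    have "?Y ** mpoch_nat N k = mpoch_nat N k ** ?Y"
      using mpoch_nat_shift_commute[of N 0 k "of_nat k" p] by (simp add: mat_def flip: zero_vec_def)
    also have "\<dots> = ?X ** mpoch_nat M k"
      unfolding e(1) by (metis mpoch_nat_add add.commute)
    finally show ?thesis .
  qed
  have "matrix_inv ?X ** mpoch_nat N k = matrix_inv ?X ** (matrix_inv ?Y ** ?Y) ** mpoch_nat N k"
    using Y(1) by (simp add: invertible_matrix_inv)
  also have "\<dots> = matrix_inv ?X ** matrix_inv ?Y ** (?X ** mpoch_nat M k)"
    by (simp add: YN flip: matrix_mul_assoc)
  also have "matrix_inv ?X ** matrix_inv ?Y = matrix_inv ?Y ** matrix_inv ?X"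
    using XY X(1) Y(1) by (metis matrix_inv_commute)
  also have "matrix_inv ?Y ** matrix_inv ?X ** (?X ** mpoch_nat M k) =
      matrix_inv ?Y ** (matrix_inv ?X ** ?X) ** mpoch_nat M k"
    by (simp flip: matrix_mul_assoc)
  also have "\<dots> = matrix_inv ?Y ** mpoch_nat M k"
    using X(1) by (simp add: invertible_matrix_inv)
  finally show ?thesis by (simp add: X(2) Y(2) e(2))
qed

lemma pochhammer_nonneg_real: "0 \<le> (x::real) \<Longrightarrow> 0 \<le> pochhammer x n"
  by (induction n) (auto simp: pochhammer_Suc)

lemma opnorm_mpoch_nat: "opnorm (mpoch_nat M n) \<le> pochhammer (opnorm M) n"
proof (induction n)
  case (Suc n)
  have "opnorm (mpoch_nat M (Suc n)) \<le> opnorm (mpoch_nat M n) * opnorm (M + mat (of_nat n))"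
    by (simp add: opnorm_mult)
  also have "\<dots> \<le> pochhammer (opnorm M) n * (opnorm M + real n)"
    using opnorm_add[of M "mat (of_nat n)"] opnorm_mat[of "of_nat n :: complex"]
    by (intro mult_mono Suc) (auto intro: order_trans pochhammer_nonneg_real)
  finally show ?case by (simp add: pochhammer_Suc)
qed (simp add: opnorm_one)

section \<open>Growth of Pochhammer symbols\<close>

text \<open>
  From some index \<open>K\<close> on, each step multiplies by less than \<open>q\<close>; the finitely many earlier values are absorbed
  in \<open>C\<close>.
\<close>
lemma geometric_bound_of_ratio_tendsto_1:
  fixes a r :: "nat \<Rightarrow> real"
  assumes nonneg: "\<And>k. 0 \<le> a k"
    and step: "eventually (\<lambda>k. a (Suc k) \<le> r k * a k) sequentially"
    and lim: "r \<longlonglongrightarrow> 1" and "q > 1"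
  shows "\<exists>C\<ge>0. \<forall>k. a k \<le> C * q ^ k"
proof -
  have "eventually (\<lambda>k. r k < q) sequentially"
    using lim \<open>q > 1\<close> by (rule order_tendstoD)
  with step have "eventually (\<lambda>k. a (Suc k) \<le> q * a k) sequentially"
    by eventually_elim (meson nonneg less_imp_le mult_right_mono order_trans)
  then obtain K where K: "\<And>k. k \<ge> K \<Longrightarrow> a (Suc k) \<le> q * a k"
    by (auto simp: eventually_sequentially)
  define C where "C = (\<Sum>j\<le>K. a j)"
  have C: "C \<ge> 0" unfolding C_def by (intro sum_nonneg nonneg)
  have small: "a k \<le> C * q ^ k" if "k \<le> K" for k
  proof -
    have "a k \<le> C" unfolding C_def using that nonneg by (intro member_le_sum) auto
    also have "C * 1 \<le> C * q ^ k" using C \<open>q > 1\<close> by (intro mult_left_mono one_le_power) auto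
    finally show ?thesis by simp
  qed
  have "a k \<le> C * q ^ k" if "k \<ge> K" for k
    using that
  proof (induction k rule: dec_induct)
    case (step k)
    have "a (Suc k) \<le> q * (C * q ^ k)"
      using K[of k] step \<open>q > 1\<close> by (intro order_trans[OF K] mult_left_mono) auto
    thus ?case by (simp add: mult_ac)
  qed (use small in auto)
  with small C show ?thesis by (metis nat_le_linear)
qed

lemma shift_ratio_tendsto_1: "(\<lambda>k. (\<alpha> + real k) / (real k + 1 - \<beta>)) \<longlonglongrightarrow> 1"
proof -
  have "filterlim (\<lambda>k. (1 - \<beta>) + real k) at_top sequentially"
    by (rule filterlim_tendsto_add_at_top[OF tendsto_const filterlim_real_sequentially])
  hence "(\<lambda>k. inverse ((1 - \<beta>) + real k)) \<longlonglongrightarrow> 0"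
    by (rule tendsto_inverse_0_at_top)
  hence "(\<lambda>k. 1 + (\<alpha> + \<beta> - 1) * inverse ((1 - \<beta>) + real k)) \<longlonglongrightarrow> 1 + (\<alpha> + \<beta> - 1) * 0"
    by (intro tendsto_intros)
  hence "(\<lambda>k. 1 + (\<alpha> + \<beta> - 1) * inverse ((1 - \<beta>) + real k)) \<longlonglongrightarrow> 1"
    by (simp only: mult_zero_right add_0_right)
  moreover have "eventually (\<lambda>k. 1 + (\<alpha> + \<beta> - 1) * inverse ((1 - \<beta>) + real k) =
      (\<alpha> + real k) / (real k + 1 - \<beta>)) sequentially"
    using eventually_gt_at_top[of "nat \<lceil>\<bar>\<beta>\<bar>\<rceil>"]
  proof eventually_elim
    case (elim k)
    hence "real k + 1 - \<beta> \<noteq> 0" by linarith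
    thus ?case by (simp add: field_simps)
  qed
  ultimately show ?thesis by (rule Lim_transform_eventually)
qed

lemma opnorm_mpoch_nat_Suc:
  "opnorm (mpoch_nat M (Suc n)) \<le> (opnorm M + real n) * opnorm (mpoch_nat M n)"
proof -
  have "opnorm (mpoch_nat M (Suc n)) \<le> opnorm (mpoch_nat M n) * opnorm (M + mat (of_nat n))"
    by (simp add: opnorm_mult)
  also have "\<dots> \<le> opnorm (mpoch_nat M n) * (opnorm M + real n)"
    using opnorm_add[of M "mat (of_nat n)"] opnorm_mat[of "of_nat n :: complex", where 'd='a]
    by (intro mult_left_mono) auto
  finally show ?thesis by (simp add: mult.commute)
qed

lemma mpoch_nat_growth:
  assumes "q > 1"
  shows "\<exists>C\<ge>0. \<forall>N. opnorm (mpoch_nat A N) \<le> C * q ^ N * fact N"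
proof -
  have "\<exists>C\<ge>0. \<forall>N. opnorm (mpoch_nat A N) / fact N \<le> C * q ^ N"
  proof (rule geometric_bound_of_ratio_tendsto_1)
    show "(\<lambda>k. (opnorm A + real k) / (real k + 1 - 0)) \<longlonglongrightarrow> 1" by (rule shift_ratio_tendsto_1)
    show "\<forall>\<^sub>F k in sequentially. opnorm (mpoch_nat A (Suc k)) / fact (Suc k) \<le>
      (opnorm A + real k) / (real k + 1 - 0) * (opnorm (mpoch_nat A k) / fact k)"
    proof (intro always_eventually allI)
      fix k
      have "opnorm (mpoch_nat A (Suc k)) / fact (Suc k) \<le>
          ((opnorm A + real k) * opnorm (mpoch_nat A k)) / fact (Suc k)"
        by (intro divide_right_mono opnorm_mpoch_nat_Suc) simp
      thus "opnorm (mpoch_nat A (Suc k)) / fact (Suc k) \<le>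
        (opnorm A + real k) / (real k + 1 - 0) * (opnorm (mpoch_nat A k) / fact k)"
        by (simp add: add.commute)
    qed
  qed (use assms in auto)
  thus ?thesis by (simp add: field_simps)
qed

text \<open>
  From \<open>c Y = 1 + M Y\<close>, estimated in norm and solved for the norm of \<open>Y\<close>.
\<close>
lemma opnorm_resolvent:
  fixes M Y :: "complex^'d^'d"
  assumes "(mat c - M) ** Y = mat 1" "opnorm M < norm c"
  shows "opnorm Y \<le> 1 / (norm c - opnorm M)"
proof -
  have c: "c \<noteq> 0" using assms(2) opnorm_nonneg[of M] by (auto simp: not_less[symmetric] simp del: opnorm_nonneg)
  have "(mat c - M) ** Y + M ** Y = cscale c Y"
    by (simp add: cscale_eq_mat_mult flip: matrix_mult_add_left)
  hence e: "Y = cscale (1 / c) (mat 1 + M ** Y)"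
    using c by (simp add: assms(1))
  have "opnorm Y \<le> norm (1 / c) * opnorm (mat 1 + M ** Y)"
    by (subst e) (rule opnorm_cscale)
  also have "\<dots> \<le> norm (1 / c) * (1 + opnorm M * opnorm Y)"
    using opnorm_add[of "mat 1" "M ** Y"] opnorm_mult[of M Y] opnorm_one[where 'a='d]
    by (intro mult_left_mono) auto
  finally have "norm c * opnorm Y \<le> 1 + opnorm M * opnorm Y"
    using c by (simp add: norm_divide field_simps)
  thus ?thesis using assms(2) by (simp add: field_simps)
qed

lemma matrix_inv_mult:
  fixes X Y :: "complex^'d^'d"
  assumes "invertible X" "invertible Y"
  shows "matrix_inv (X ** Y) = matrix_inv Y ** matrix_inv X"
proof (rule matrix_inv_unique)
  have "X ** Y ** (matrix_inv Y ** matrix_inv X) = X ** (Y ** matrix_inv Y) ** matrix_inv X"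
    by (simp add: matrix_mul_assoc)
  thus "X ** Y ** (matrix_inv Y ** matrix_inv X) = mat 1"
    using assms by (simp add: invertible_matrix_inv)
qed

lemma invertible_mult_right_factor:
  fixes X Y :: "complex^'d^'d"
  assumes "invertible (X ** Y)"
  shows "invertible Y"
  using invertible_matrix_inv(2)[OF assms] unfolding invertible_left_inverse
  by (metis matrix_mul_assoc)

lemma opnorm_mpoch_neg_Suc:
  fixes M :: "complex^'d^'d"
  assumes "mpoch_defined M" "opnorm M < real p + 1"
  shows "opnorm (matrix_inv (mpoch_nat (mat 1 - M) (Suc p))) \<le>
     1 / (real p + 1 - opnorm M) * opnorm (matrix_inv (mpoch_nat (mat 1 - M) p))"
proof -
  let ?X = "mpoch_nat (mat 1 - M) p" and ?Y = "mat 1 - M + mat (of_nat p)"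
  have X: "invertible ?X" using assms by (simp add: mpoch_defined_def)
  have "invertible (?X ** ?Y)" using assms(1) by (metis mpoch_defined_def mpoch_nat.simps(2))
  hence Y: "invertible ?Y" by (rule invertible_mult_right_factor)
  have Y': "?Y = mat (of_nat (Suc p)) - M" by (simp add: vec_eq_iff mat_def)
  have n: "norm (of_nat (Suc p) :: complex) = real p + 1" by (metis norm_of_nat of_nat_Suc add.commute)
  have "opnorm (matrix_inv ?Y) \<le> 1 / (norm (of_nat (Suc p) :: complex) - opnorm M)"
    using invertible_matrix_inv(1)[OF Y] assms(2) unfolding n[symmetric]
    by (intro opnorm_resolvent) (simp_all only: Y')
  hence "opnorm (matrix_inv ?Y) \<le> 1 / (real p + 1 - opnorm M)" unfolding n .
  hence "opnorm (matrix_inv ?Y) * opnorm (matrix_inv ?X)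
      \<le> 1 / (real p + 1 - opnorm M) * opnorm (matrix_inv ?X)"
    by (intro mult_right_mono) auto
  moreover have "matrix_inv (mpoch_nat (mat 1 - M) (Suc p)) = matrix_inv ?Y ** matrix_inv ?X"
    using X Y by (simp add: matrix_inv_mult)
  ultimately show ?thesis using opnorm_mult[of "matrix_inv ?Y" "matrix_inv ?X"] by simp
qed

text \<open>
  The factor \<open>(M)\<^sub>k\<close> grows like \<open>k!\<close> and \<open>(N)\<^sub>-\<^sub>k\<close> decays like \<open>1 / k!\<close>: passing from \<open>k\<close> to \<open>k + 1\<close> multiplies the
  product of the norms by at most \<open>(\<mu> + k) / (k + 1 - \<nu>)\<close>, where \<open>\<mu>\<close> and \<open>\<nu>\<close> are the norms of \<open>M\<close> and \<open>N\<close>, once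
  \<open>k + 1 > \<nu>\<close>.
\<close>
lemma mpoch_opposite_growth:
  fixes M N :: "complex^'d^'d"
  assumes "mpoch_defined N" "q > 1"
  shows "\<exists>C\<ge>0. \<forall>k. opnorm (mpoch M (int k)) * opnorm (mpoch N (- int k)) \<le> C * q ^ k"
proof -
  define b where "b k = opnorm (matrix_inv (mpoch_nat (mat 1 - N) k))" for k
  have b: "opnorm (mpoch N (- int k)) \<le> b k" for k
    using opnorm_cscale[of "(-1) ^ k" "matrix_inv (mpoch_nat (mat 1 - N) k)"]
    by (cases "k = 0") (auto simp: mpoch_def b_def norm_power matrix_inv_unique)
  have b0: "0 \<le> b k" for k by (simp add: b_def)
  have "\<exists>C\<ge>0. \<forall>k. opnorm (mpoch_nat M k) * b k \<le> C * q ^ k"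
  proof (rule geometric_bound_of_ratio_tendsto_1)
    show "(\<lambda>k. (opnorm M + real k) / (real k + 1 - opnorm N)) \<longlonglongrightarrow> 1"
      by (rule shift_ratio_tendsto_1)
    show "\<forall>\<^sub>F k in sequentially. opnorm (mpoch_nat M (Suc k)) * b (Suc k) \<le>
      (opnorm M + real k) / (real k + 1 - opnorm N) * (opnorm (mpoch_nat M k) * b k)"
      using eventually_gt_at_top[of "nat \<lceil>opnorm N\<rceil>"]
    proof eventually_elim
      case (elim k)
      hence "opnorm N < real k + 1" by linarith
      hence "b (Suc k) \<le> 1 / (real k + 1 - opnorm N) * b k"
        unfolding b_def by (intro opnorm_mpoch_neg_Suc assms)
      hence "opnorm (mpoch_nat M (Suc k)) * b (Suc k) \<le>
        ((opnorm M + real k) * opnorm (mpoch_nat M k)) * (1 / (real k + 1 - opnorm N) * b k)"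
        by (intro mult_mono opnorm_mpoch_nat_Suc b0) auto
      thus ?case by (simp add: field_simps)
    qed
  qed (use assms b0 in auto)
  then obtain C where C: "C \<ge> 0" "\<And>k. opnorm (mpoch_nat M k) * b k \<le> C * q ^ k" by blast
  have "opnorm (mpoch M (int k)) * opnorm (mpoch N (- int k)) \<le> C * q ^ k" for k
    using C(2)[of k] mult_left_mono[OF b[of k], of "opnorm (mpoch_nat M k)"] by simp
  with C(1) show ?thesis by blast
qed

lemma mpoch_opposite_growth_int:
  fixes B B' :: "complex^'d^'d"
  assumes "mpoch_defined B" "mpoch_defined B'" "q > 1"
  shows "\<exists>C\<ge>0. \<forall>l. opnorm (mpoch B (- l)) * opnorm (mpoch B' l) \<le> C * q ^ nat \<bar>l\<bar>"
proof -
  obtain C1 where C1: "C1 \<ge> 0" "\<And>k. opnorm (mpoch B (int k)) * opnorm (mpoch B' (- int k)) \<le> C1 * q ^ k"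
    using mpoch_opposite_growth[OF assms(2,3), of B] by blast
  obtain C2 where C2: "C2 \<ge> 0" "\<And>k. opnorm (mpoch B' (int k)) * opnorm (mpoch B (- int k)) \<le> C2 * q ^ k"
    using mpoch_opposite_growth[OF assms(1,3), of B'] by blast
  have q: "0 \<le> C1 * q ^ k" "0 \<le> C2 * q ^ k" for k using C1 C2 assms by auto
  have "opnorm (mpoch B (- l)) * opnorm (mpoch B' l) \<le> (C1 + C2) * q ^ nat \<bar>l\<bar>" for l
  proof (cases "l \<ge> 0")
    case True
    then obtain k where "l = int k" by (metis nonneg_eq_int)
    thus ?thesis using C2(2)[of k] q(1)[of k] by (simp add: algebra_simps)
  next
    case False
    then obtain k where "l = - int k" by (metis int_cases2 of_nat_0_le_iff)
    thus ?thesis using C1(2)[of k] q(2)[of k] by (simp add: algebra_simps)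
  qed
  thus ?thesis using C1(1) C2(1) by (intro exI[of _ "C1 + C2"]) auto
qed

text \<open>
  Summed along the antidiagonals \<open>m + n = k\<close> this is the geometric series of \<open>X + Y\<close>.
\<close>
lemma binomial_double_series_summable:
  fixes X Y :: real
  assumes "0 \<le> X" "0 \<le> Y" "X + Y < 1"
  shows "(\<lambda>(m,n). real (m + n choose m) * X ^ m * Y ^ n) summable_on UNIV"
proof (rule nonneg_bdd_above_summable_on)
  let ?f = "\<lambda>(m,n). real (m + n choose m) * X ^ m * Y ^ n"
  have tri: "sum ?f {(i,j). i + j \<le> K} \<le> 1 / (1 - (X + Y))" for K
  proof -
    have "sum ?f {(i,j). i + j \<le> K} = (\<Sum>k\<le>K. \<Sum>i\<le>k. real (i + (k - i) choose i) * X ^ i * Y ^ (k - i))"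
      by (rule sum.triangle_reindex_eq)
    also have "\<dots> = (\<Sum>k\<le>K. (X + Y) ^ k)"
      by (intro sum.cong refl) (simp add: binomial_ring mult.assoc)
    also have "\<dots> \<le> 1 / (1 - (X + Y))"
      using sum_le_suminf[OF summable_geometric[of "X + Y"], of "{..K}"] assms
      by (simp add: suminf_geometric)
    finally show ?thesis .
  qed
  show "bdd_above (sum ?f ` {F. F \<subseteq> UNIV \<and> finite F})"
  proof (rule bdd_aboveI2)
    fix F :: "(nat \<times> nat) set" assume "F \<in> {F. F \<subseteq> UNIV \<and> finite F}"
    hence F: "finite F" by auto
    define K where "K = (\<Sum>(i,j)\<in>F. i + j)"
    have "F \<subseteq> {(i,j). i + j \<le> K}"
    proof safe
      fix i j assume "(i, j) \<in> F"
      thus "i + j \<le> K" unfolding K_def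
        using member_le_sum[of "(i,j)" F "\<lambda>(i,j). i + j"] F by auto
    qed
    moreover have "finite {(i,j). i + j \<le> K}"
      by (rule finite_subset[of _ "{..K} \<times> {..K}"]) auto
    ultimately have "sum ?f F \<le> sum ?f {(i,j). i + j \<le> K}"
      using assms by (intro sum_mono2) auto
    with tri[of K] show "sum ?f F \<le> 1 / (1 - (X + Y))" by linarith
  qed
qed (use assms in auto)

text \<open>
  The factors \<open>B\<close> and \<open>B'\<close> enter with opposite indices, and it is the product of their norms that grows slowly.
  The three norms are multiplied, instead of taking the norm of the product, because the first summation
  formula inserts a matrix in the middle of the term.
\<close>
definition horn_majorant ::
  "complex^'d^'d \<Rightarrow> complex^'d^'d \<Rightarrow> complex^'d^'d \<Rightarrow> real \<Rightarrow> real \<Rightarrow> nat \<times> nat \<Rightarrow> real" where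
  "horn_majorant A B B' X Y = (\<lambda>(m, n). X ^ m * Y ^ n / (fact m * fact n) *
     (opnorm (mpoch_nat A (m + n)) *
       (opnorm (mpoch B (int n - int m)) * opnorm (mpoch B' (int m - int n)))))"

text \<open>
  The additional factor \<open>\<rho>\<^sup>m\<^sup>+\<^sup>n\<close> leaves room for the matrix powers \<open>P s (M + l)\<close> with \<open>\<bar>l\<bar> \<le> m + n\<close>.
\<close>
lemma horn_majorant_summable:
  fixes A B B' :: "complex^'d^'d" and X Y :: real
  assumes "mpoch_defined B" "mpoch_defined B'" "0 \<le> X" "0 \<le> Y" "X + Y < 1"
  shows "\<exists>\<rho>>1. (\<lambda>(m, n). horn_majorant A B B' X Y (m, n) * \<rho> ^ (m + n)) summable_on UNIV"
proof -
  \<comment> \<open>One factor \<open>q\<close> each pays for the growth of \<open>A\<close>, for that of \<open>B\<close> and \<open>B'\<close>, and for \<open>\<rho>\<close>.\<close>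
  have "((\<lambda>q. q ^ 3 * (X + Y)) \<longlongrightarrow> 1 ^ 3 * (X + Y)) (at_right 1)"
    by (intro tendsto_intros)
  hence "eventually (\<lambda>q. q ^ 3 * (X + Y) < 1) (at_right 1)"
    using assms by (auto dest: order_tendstoD)
  hence "eventually (\<lambda>q. q ^ 3 * (X + Y) < 1 \<and> 1 < q) (at_right 1)"
    using eventually_at_right_less by (rule eventually_conj)
  hence "\<exists>q>1. q ^ 3 * (X + Y) < 1"
    using eventually_happens[of _ "at_right (1::real)"] by (auto simp: trivial_limit_at_right_real)
  then obtain q where q: "q > 1" "q ^ 3 * (X + Y) < 1" by blast
  obtain C where C: "C \<ge> 0" "\<And>N. opnorm (mpoch_nat A N) \<le> C * q ^ N * fact N"
    using mpoch_nat_growth[OF q(1)] by blast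
  obtain D where D: "D \<ge> 0" "\<And>l. opnorm (mpoch B (- l)) * opnorm (mpoch B' l) \<le> D * q ^ nat \<bar>l\<bar>"
    using mpoch_opposite_growth_int[OF assms(1,2) q(1)] by blast
  have bound: "horn_majorant A B B' X Y (m, n) * q ^ (m + n) \<le>
      C * D * (real (m + n choose m) * (q ^ 3 * X) ^ m * (q ^ 3 * Y) ^ n)" for m n
  proof -
    have "opnorm (mpoch B (int n - int m)) * opnorm (mpoch B' (int m - int n)) \<le>
        D * q ^ nat \<bar>int m - int n\<bar>"
      using D(2)[of "int m - int n"] by simp
    also have "\<dots> \<le> D * q ^ (m + n)"
      using D(1) q(1) by (intro mult_left_mono power_increasing) auto
    finally have "opnorm (mpoch_nat A (m + n)) *
        (opnorm (mpoch B (int n - int m)) * opnorm (mpoch B' (int m - int n))) \<le>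
        (C * q ^ (m + n) * fact (m + n)) * (D * q ^ (m + n))"
      using C q(1) by (intro mult_mono[OF C(2)]) auto
    hence "horn_majorant A B B' X Y (m, n) * q ^ (m + n) \<le> X ^ m * Y ^ n / (fact m * fact n) *
        ((C * q ^ (m + n) * fact (m + n)) * (D * q ^ (m + n))) * q ^ (m + n)"
      unfolding horn_majorant_def prod.case using assms q(1)
      by (intro mult_right_mono mult_left_mono) auto
    also have "\<dots> = C * D * (real (m + n choose m) * (q ^ 3 * X) ^ m * (q ^ 3 * Y) ^ n)"
      by (simp add: binomial_fact power_mult_distrib power_add power3_eq_cube field_simps)
    finally show ?thesis .
  qed
  have "(\<lambda>(m,n). real (m + n choose m) * (q ^ 3 * X) ^ m * (q ^ 3 * Y) ^ n) summable_on UNIV"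
    using q assms by (intro binomial_double_series_summable) (auto simp: algebra_simps)
  hence S: "(\<lambda>p. C * D * (case p of (m,n) \<Rightarrow> real (m + n choose m) * (q ^ 3 * X) ^ m * (q ^ 3 * Y) ^ n))
      summable_on UNIV"
    by (rule summable_on_cmult_right)
  have "(\<lambda>p. norm (case p of (m, n) \<Rightarrow> horn_majorant A B B' X Y (m, n) * q ^ (m + n))) summable_on UNIV"
    by (rule Infinite_Sum.abs_summable_on_comparison_test'[OF S])
       (use bound assms q in \<open>auto simp: horn_majorant_def abs_mult\<close>)
  hence "(\<lambda>(m, n). horn_majorant A B B' X Y (m, n) * q ^ (m + n)) summable_on UNIV"
    by (rule abs_summable_summable)
  with q(1) show ?thesis by blast
qed

section \<open>The matrix binomial series\<close>

lemma matrix_sums_iff: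
  fixes f :: "nat \<Rightarrow> complex^'d^'d"
  shows "f sums S \<longleftrightarrow> (\<forall>i j. (\<lambda>k. f k $ i $ j) sums (S $ i $ j))"
proof
  assume "f sums S"
  thus "\<forall>i j. (\<lambda>k. f k $ i $ j) sums (S $ i $ j)"
    by (blast intro: bounded_linear.sums[OF bounded_linear_entry])
next
  assume "\<forall>i j. (\<lambda>k. f k $ i $ j) sums (S $ i $ j)"
  thus "f sums S"
    unfolding sums_def by (intro vec_tendstoI) (simp add: sum_component)
qed

text \<open>
  For \<open>c \<noteq> 0\<close> scaling is invertible, so both families are summable or neither is.
\<close>
lemma infsum_cscale: "infsum (\<lambda>i. cscale c (f i)) I = cscale c (infsum f I)"
proof (rule infsum_bounded_linear_strong')
  assume "c \<noteq> 0"
  thus "(\<lambda>i. cscale c (f i)) summable_on I \<longleftrightarrow> f summable_on I"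
    by (intro summable_on_bounded_linear_iff[of "cscale c" "cscale (1 / c)"] bounded_linear_cscale) auto
qed (auto simp: bounded_linear_cscale vec_eq_iff)

lemma infsum_matrix_mult_left:
  fixes P :: "complex^'d^'d" and f :: "'i \<Rightarrow> complex^'d^'d"
  assumes "f summable_on I"
  shows "infsum (\<lambda>i. P ** f i) I = P ** infsum f I"
  using has_sum_bounded_linear[OF bounded_linear_matrix_mult_left has_sum_infsum[OF assms]]
  by (rule infsumI)

lemma infsum_matrix_mult_right:
  fixes P :: "complex^'d^'d" and f :: "'i \<Rightarrow> complex^'d^'d"
  assumes "f summable_on I"
  shows "infsum (\<lambda>i. f i ** P) I = infsum f I ** P"
  using has_sum_bounded_linear[OF bounded_linear_matrix_mult_right has_sum_infsum[OF assms]]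
  by (rule infsumI)

lemma summable_on_if_opnorm_le:
  fixes f :: "'i \<Rightarrow> complex^'d^'d"
  assumes "g summable_on I" "\<And>i. i \<in> I \<Longrightarrow> opnorm (f i) \<le> g i"
  shows "(\<lambda>i. norm (f i)) summable_on I" "f summable_on I"
proof -
  show "(\<lambda>i. norm (f i)) summable_on I"
  proof (rule Infinite_Sum.abs_summable_on_comparison_test'[OF summable_on_cmult_right[OF assms(1)]])
    fix i assume "i \<in> I"
    show "norm (f i) \<le> real (CARD('d))^2 * g i"
      by (rule order_trans[OF norm_le_opnorm mult_left_mono[OF assms(2)[OF \<open>i \<in> I\<close>]]]) simp
  qed
  thus "f summable_on I" by (rule abs_summable_summable)
qed

lemma pochhammer_series:
  fixes \<sigma> c :: real
  assumes "\<bar>\<sigma>\<bar> < 1"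
  shows "(\<lambda>k. pochhammer c k / fact k * \<sigma> ^ k) sums (1 - \<sigma>) powr (- c)"
proof -
  have "(\<lambda>k. (- c gchoose k) * (- \<sigma>) ^ k) sums (1 + (- \<sigma>)) powr (- c)"
    by (rule gen_binomial_real) (use assms in simp)
  moreover have "(- c gchoose k) * (- \<sigma>) ^ k = pochhammer c k / fact k * \<sigma> ^ k" for k
    by (simp add: gbinomial_pochhammer flip: power_mult_distrib)
  ultimately show ?thesis by simp
qed

lemma pochhammer_has_sum:
  fixes \<sigma> c :: real
  assumes "0 \<le> \<sigma>" "\<sigma> < 1" "0 \<le> c"
  shows "((\<lambda>k. pochhammer c k / fact k * \<sigma> ^ k) has_sum (1 - \<sigma>) powr (- c)) UNIV"
  using assms pochhammer_series[of \<sigma> c]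
  by (intro sums_nonneg_imp_has_sum) (auto simp: pochhammer_nonneg_real)

lemma pochhammer_mono_real:
  fixes a b :: real
  assumes "0 \<le> a" "a \<le> b"
  shows "pochhammer a n \<le> pochhammer b n"
  using assms by (induction n) (auto simp: pochhammer_Suc intro!: mult_mono pochhammer_nonneg_real)

lemma opnorm_binomial_term:
  fixes L M R :: "complex^'d^'d"
  assumes "opnorm M \<le> c"
  shows "opnorm (cscale (s ^ k / fact k) (L ** mpoch_nat M k ** R)) \<le>
    opnorm L * opnorm R * (pochhammer c k / fact k * norm s ^ k)"
proof -
  have "opnorm (L ** mpoch_nat M k ** R) \<le> opnorm L * pochhammer c k * opnorm R"
    using opnorm_mpoch_nat[of M k] pochhammer_mono_real[OF opnorm_nonneg assms, of k]
    by (intro order_trans[OF opnorm_mult] mult_right_mono order_trans[OF opnorm_mult]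
        mult_left_mono) auto
  hence "norm (s ^ k / fact k) * opnorm (L ** mpoch_nat M k ** R) \<le>
      norm (s ^ k / fact k) * (opnorm L * pochhammer c k * opnorm R)"
    by (intro mult_left_mono) auto
  also have "norm (s ^ k / fact k) * (opnorm L * pochhammer c k * opnorm R) =
      opnorm L * opnorm R * (pochhammer c k / fact k * norm s ^ k)"
    by (simp add: norm_divide norm_power norm_fact)
  finally have "norm (s ^ k / fact k) * opnorm (L ** mpoch_nat M k ** R) \<le>
      opnorm L * opnorm R * (pochhammer c k / fact k * norm s ^ k)" .
  thus ?thesis by (rule order_trans[OF opnorm_cscale])
qed

lemma one_minus_mpow_neg_has_sum:
  fixes M :: "complex^'d^'d"
  assumes "norm s < 1"
  shows "((\<lambda>k. cscale (s ^ k / fact k) (mpoch_nat M k)) has_sum one_minus_mpow_neg s M) UNIV"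
proof -
  have "(\<lambda>k. pochhammer (opnorm M) k / fact k * norm s ^ k) summable_on UNIV"
    using pochhammer_has_sum[of "norm s" "opnorm M"] assms by (auto dest: has_sum_imp_summable)
  moreover have "opnorm (cscale (s ^ k / fact k) (mpoch_nat M k)) \<le>
      pochhammer (opnorm M) k / fact k * norm s ^ k" for k
  proof -
    have "opnorm (cscale (s ^ k / fact k) (mat 1 ** mpoch_nat M k ** mat 1)) \<le>
      opnorm (mat 1 :: complex^'d^'d) * opnorm (mat 1 :: complex^'d^'d) * (pochhammer (opnorm M) k / fact k * norm s ^ k)"
      by (rule opnorm_binomial_term) simp
    also have "\<dots> \<le> 1 * 1 * (pochhammer (opnorm M) k / fact k * norm s ^ k)"
      by (intro mult_right_mono mult_mono opnorm_one) (auto simp: pochhammer_nonneg_real)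
    finally show ?thesis by simp
  qed
  ultimately have "(\<lambda>k. cscale (s ^ k / fact k) (mpoch_nat M k)) summable_on UNIV"
    by (rule summable_on_if_opnorm_le)
  hence "((\<lambda>k. cscale (s ^ k / fact k) (mpoch_nat M k)) has_sum
      (\<Sum>\<^sub>\<infinity>k. cscale (s ^ k / fact k) (mpoch_nat M k))) UNIV" by (rule has_sum_infsum)
  moreover from this have "one_minus_mpow_neg s M = (\<Sum>\<^sub>\<infinity>k. cscale (s ^ k / fact k) (mpoch_nat M k))"
    unfolding one_minus_mpow_neg_def by (intro sums_unique[symmetric] has_sum_imp_sums)
  ultimately show ?thesis by simp
qed

lemmas one_minus_mpow_neg_sums = has_sum_imp_sums[OF one_minus_mpow_neg_has_sum]

lemma one_minus_mpow_neg_commute: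
  assumes "norm s < 1" "X ** M = M ** X"
  shows "X ** one_minus_mpow_neg s M = one_minus_mpow_neg s M ** X"
proof -
  note 1 = has_sum_bounded_linear[OF bounded_linear_matrix_mult_left[of X] one_minus_mpow_neg_has_sum[OF assms(1)], of M]
  note 2 = has_sum_bounded_linear[OF bounded_linear_matrix_mult_right[of X] one_minus_mpow_neg_has_sum[OF assms(1)], of M]
  show ?thesis
    using 1 2 commute_mpoch_nat[OF assms(2)]
    by (simp add: cscale_mult_left cscale_mult_right has_sum_unique)
qed

text \<open>
  The scalar rule \<open>(1 - s)\<^sup>-\<^sup>M = (1 - s) (1 - s)\<^sup>-\<^sup>(\<^sup>M\<^sup>+\<^sup>1\<^sup>)\<close>, proved by comparing coefficients: \<open>(M + 1)\<^sub>k\<^sub>+\<^sub>1\<close>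
  exceeds \<open>(M)\<^sub>k\<^sub>+\<^sub>1\<close> by \<open>(k + 1) (M + 1)\<^sub>k\<close>.
\<close>
lemma one_minus_mpow_neg_Suc:
  fixes M :: "complex^'d^'d"
  assumes s: "norm s < 1"
  shows "one_minus_mpow_neg s M = cscale (1 - s) (one_minus_mpow_neg s (M + mat 1))"
proof -
  define f where "f k = cscale (s ^ k / fact k) (mpoch_nat (M + mat 1) k)" for k
  define h where "h k = cscale (s ^ k / fact k) (mpoch_nat M k)" for k
  let ?Q = "one_minus_mpow_neg s (M + mat 1)"
  have f: "f sums ?Q"
    unfolding f_def by (rule one_minus_mpow_neg_sums[OF s])
  have h: "h (Suc k) = f (Suc k) - cscale s (f k)" for k
  proof -
    let ?Z = "mpoch_nat (M + mat 1) k"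
    have "mpoch_nat M (Suc k) = ?Z ** M"
      unfolding mpoch_nat_Suc_left by (intro commute_mpoch_nat commute_shift) simp
    also have "?Z ** M = mpoch_nat (M + mat 1) (Suc k) - cscale (of_nat (Suc k)) ?Z"
    proof -
      have "mpoch_nat (M + mat 1) (Suc k) = ?Z ** (M + mat (of_nat (Suc k)))"
        by (simp add: mat_add add.assoc)
      also have "\<dots> = ?Z ** M + cscale (of_nat (Suc k)) ?Z"
        by (simp only: matrix_add_ldistrib cscale_eq_mat_mult mat_of_complex_commute)
      finally show ?thesis by simp
    qed
    finally have "h (Suc k) = f (Suc k) - cscale (s ^ Suc k / fact (Suc k) * of_nat (Suc k)) ?Z"
      by (simp only: h_def f_def cscale_diff_right cscale_cscale)
    also have "s ^ Suc k / fact (Suc k) * of_nat (Suc k) = s * (s ^ k / fact k)"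
      by (simp add: field_simps del: of_nat_Suc)
    finally show ?thesis by (simp add: f_def)
  qed
  have h0: "h 0 = f 0" by (simp add: h_def f_def)
  have "(\<lambda>k. f (Suc k) - cscale s (f k)) sums ((?Q - f 0) - cscale s ?Q)"
    using f by (intro sums_diff bounded_linear.sums[OF bounded_linear_cscale])
      (simp add: sums_Suc_iff)
  hence "(\<lambda>k. h (Suc k)) sums ((?Q - cscale s ?Q) - h 0)"
    by (simp add: h h0 algebra_simps)
  hence "h sums (?Q - cscale s ?Q)" by (simp add: sums_Suc_iff)
  hence "one_minus_mpow_neg s M = ?Q - cscale s ?Q"
    unfolding h_def one_minus_mpow_neg_def by (rule sums_unique[symmetric])
  thus ?thesis by (simp add: vec_eq_iff algebra_simps)
qed

lemma one_minus_mpow_neg_shift_nat: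
  assumes s: "norm s < 1"
  shows "one_minus_mpow_neg s M = cscale ((1 - s) ^ n) (one_minus_mpow_neg s (M + mat (of_nat n)))"
proof (induction n)
  case (Suc n)
  have "M + mat (of_nat n) + mat 1 = M + mat (of_nat (Suc n))" by (simp add: mat_add add.assoc add.commute)
  with one_minus_mpow_neg_Suc[OF s, of "M + mat (of_nat n)"]
  have "one_minus_mpow_neg s (M + mat (of_nat n)) =
      cscale (1 - s) (one_minus_mpow_neg s (M + mat (of_nat (Suc n))))" by (simp only:)
  thus ?case by (subst Suc) (simp add: mult.commute)
qed (simp add: mat_def flip: zero_vec_def)

lemma one_minus_mpow_neg_shift:
  fixes M :: "complex^'d^'d"
  assumes s: "norm s < 1"
  shows "one_minus_mpow_neg s (M + mat (of_int l)) = cscale ((1 - s) powi (- l)) (one_minus_mpow_neg s M)"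
proof -
  have ne: "1 - s \<noteq> 0" using s by auto
  show ?thesis
  proof (cases "l \<ge> 0")
    case True
    then obtain n where n: "l = int n" by (metis nonneg_eq_int)
    show ?thesis using ne one_minus_mpow_neg_shift_nat[OF s, of M n]
      by (simp add: n power_int_minus)
  next
    case False
    then obtain n where n: "l = - int n" by (metis int_cases2 of_nat_0_le_iff)
    have "M + mat (of_int l) + mat (of_nat n) = M" by (simp add: n vec_eq_iff mat_def)
    with one_minus_mpow_neg_shift_nat[OF s, of "M + mat (of_int l)" n]
    have "one_minus_mpow_neg s (M + mat (of_int l)) = cscale ((1 - s) ^ n) (one_minus_mpow_neg s M)"
      by (simp only:)
    thus ?thesis by (simp add: n)
  qed
qed

text \<open>
  Fubini for the family \<open>s\<^sup>k / k! L\<^sub>i (M + l\<^sub>i)\<^sub>k R\<^sub>i\<close>.  Summing the norms over \<open>k\<close> first is a scalar binomial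
  series with value at most a constant times \<open>(1 - norm s)\<^sup>-\<^sup>|\<^sup>l\<^sup>|\<close> for \<open>l = l\<^sub>i\<close>, and the bound on \<open>s\<close> is chosen so
  that \<open>1 / (1 - norm s) \<le> \<rho>\<close>.
\<close>
lemma binomial_series_interchange:
  fixes L R :: "'i \<Rightarrow> complex^'d^'d" and l :: "'i \<Rightarrow> int"
  assumes u: "(\<lambda>i. opnorm (L i) * opnorm (R i) * \<rho> ^ nat \<bar>l i\<bar>) summable_on UNIV"
    and "\<rho> > 1" and s: "norm s \<le> 1 - 1 / \<rho>"
  shows "(\<lambda>k. cscale (s ^ k / fact k) (\<Sum>\<^sub>\<infinity>i. L i ** mpoch_nat (M + mat (of_int (l i))) k ** R i)) sums
         (\<Sum>\<^sub>\<infinity>i. L i ** one_minus_mpow_neg s (M + mat (of_int (l i))) ** R i)"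
proof -
  have s1: "norm s < 1" using s \<open>\<rho> > 1\<close> by (smt (verit) divide_pos_pos)
  define f where "f i k = cscale (s ^ k / fact k) (L i ** mpoch_nat (M + mat (of_int (l i))) k ** R i)" for i k
  define c where "c i = opnorm M + real (nat \<bar>l i\<bar>)" for i
  define g where "g = (\<lambda>(i, k). opnorm (L i) * opnorm (R i) * (pochhammer (c i) k / fact k * norm s ^ k))"
  have c0: "0 \<le> c i" for i by (simp add: c_def)
  have fg: "opnorm (f i k) \<le> g (i, k)" for i k
  proof -
    have "opnorm (M + mat (of_int (l i))) \<le> opnorm M + norm (of_int (l i) :: complex)"
      by (intro order_trans[OF opnorm_add] add_left_mono opnorm_mat)
    hence "opnorm (M + mat (of_int (l i))) \<le> c i" by (simp add: c_def)
    thus ?thesis unfolding f_def g_def prod.case by (rule opnorm_binomial_term)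
  qed
  define G where "G i = opnorm (L i) * opnorm (R i) * (1 - norm s) powr (- c i)" for i
  have gG: "((\<lambda>k. g (i, k)) has_sum G i) UNIV" for i
    unfolding g_def prod.case G_def
    by (intro has_sum_cmult_right pochhammer_has_sum s1 c0) simp
  have G: "norm (G i) \<le> (1 - norm s) powr (- opnorm M) * (opnorm (L i) * opnorm (R i) * \<rho> ^ nat \<bar>l i\<bar>)" for i
  proof -
    have "(1 - norm s) powr (- real (nat \<bar>l i\<bar>)) = (1 / (1 - norm s)) ^ nat \<bar>l i\<bar>"
      using s1 by (simp add: powr_minus powr_realpow power_one_over inverse_eq_divide del: of_nat_nat)
    also have "\<dots> \<le> \<rho> ^ nat \<bar>l i\<bar>"
      using s s1 \<open>\<rho> > 1\<close> by (intro power_mono) (auto simp: field_simps)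
    finally have "(1 - norm s) powr (- c i) \<le> (1 - norm s) powr (- opnorm M) * \<rho> ^ nat \<bar>l i\<bar>"
      unfolding c_def minus_add_distrib powr_add by (intro mult_left_mono) auto
    hence "G i \<le> opnorm (L i) * opnorm (R i) * ((1 - norm s) powr (- opnorm M) * \<rho> ^ nat \<bar>l i\<bar>)"
      unfolding G_def by (intro mult_left_mono) auto
    moreover have "0 \<le> G i" by (simp add: G_def)
    ultimately show ?thesis by (simp add: mult_ac)
  qed
  have "G summable_on UNIV"
    by (rule abs_summable_summable, rule Infinite_Sum.abs_summable_on_comparison_test'[OF summable_on_cmult_right[OF u] G])
  hence "g summable_on (UNIV \<times> UNIV)"
    using gG by (intro summable_on_SigmaI[where g = G]) (auto simp: g_def c0 pochhammer_nonneg_real)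
  hence fsum: "(\<lambda>(i, k). f i k) summable_on (UNIV \<times> UNIV)"
    by (rule summable_on_if_opnorm_le) (use fg in auto)
  have inner1: "infsum (f i) UNIV = L i ** one_minus_mpow_neg s (M + mat (of_int (l i))) ** R i" for i
    unfolding f_def
    using has_sum_bounded_linear[OF bounded_linear_matrix_mult_right[of "R i"]
       has_sum_bounded_linear[OF bounded_linear_matrix_mult_left[of "L i"]
        one_minus_mpow_neg_has_sum[OF s1, of "M + mat (of_int (l i))"]]]
    by (intro infsumI) (simp add: cscale_mult_left cscale_mult_right)
  have inner2: "(\<Sum>\<^sub>\<infinity>i. f i k) = cscale (s ^ k / fact k)
      (\<Sum>\<^sub>\<infinity>i. L i ** mpoch_nat (M + mat (of_int (l i))) k ** R i)" for k
    unfolding f_def by (rule infsum_cscale)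
  have "(\<lambda>(k, i). f i k) summable_on (UNIV \<times> UNIV)"
    using fsum by (subst (asm) summable_on_swap) (simp add: case_prod_unfold)
  hence "(\<lambda>k. \<Sum>\<^sub>\<infinity>i. f i k) summable_on UNIV"
    using summable_on_Sigma_banach[of "\<lambda>k i. f i k" UNIV "\<lambda>_. UNIV"] by simp
  hence "(\<lambda>k. \<Sum>\<^sub>\<infinity>i. f i k) sums (\<Sum>\<^sub>\<infinity>k. \<Sum>\<^sub>\<infinity>i. f i k)"
    by (intro has_sum_imp_sums has_sum_infsum)
  also have "(\<Sum>\<^sub>\<infinity>k. \<Sum>\<^sub>\<infinity>i. f i k) = (\<Sum>\<^sub>\<infinity>i. \<Sum>\<^sub>\<infinity>k. f i k)"
    using infsum_swap_banach[OF fsum] by simp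
  finally show ?thesis by (simp add: inner1 inner2)
qed

section \<open>Abel's limit theorem\<close>

lemma norm_one_minus_of_real: "norm (1 - of_real x :: complex) = \<bar>1 - x\<bar>"
  by (metis norm_of_real of_real_1 of_real_diff)

text \<open>
  Expresses the sum through the deviations \<open>s n\<close> of the partial sums from their limit: these tend to \<open>0\<close>, and
  the factor \<open>1 - r\<close> offsets the value \<open>1 / (1 - r)\<close> of the geometric series.
\<close>
lemma Abel_summation_by_parts:
  fixes f :: "nat \<Rightarrow> complex" and r :: real
  assumes f: "summable f" and r: "0 \<le> r" "r < 1"
  defines "s \<equiv> \<lambda>n. (\<Sum>k\<le>n. f k) - suminf f"
  shows "summable (\<lambda>n. norm (s n * of_real r ^ n))"
    and "(\<lambda>n. f n * of_real r ^ n) sums (suminf f + (1 - of_real r) * (\<Sum>n. s n * of_real r ^ n))"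
proof -
  have "s \<longlonglongrightarrow> suminf f - suminf f"
    unfolding s_def by (rule tendsto_diff[OF summable_LIMSEQ'[OF f] tendsto_const])
  hence "Bseq s" by (rule convergent_imp_Bseq[OF convergentI])
  then obtain B where B: "\<And>n. norm (s n) \<le> B" unfolding Bseq_def by blast
  show sn: "summable (\<lambda>n. norm (s n * of_real r ^ n))"
  proof (rule summable_comparison_test')
    show "summable (\<lambda>n. B * r ^ n)" using r by (intro summable_mult summable_geometric) auto
    show "norm (norm (s n * of_real r ^ n)) \<le> B * r ^ n" for n
      using mult_right_mono[OF B[of n], of "r ^ n"] r by (simp add: norm_mult norm_power)
  qed
  define T where "T = (\<Sum>n. s n * of_real r ^ n)"
  have T: "(\<lambda>n. s n * of_real r ^ n) sums T"
    unfolding T_def by (rule summable_sums[OF summable_norm_cancel[OF sn]])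
  have "(\<lambda>n. s (Suc n) * of_real r ^ Suc n) sums (T - s 0)"
    unfolding sums_Suc_iff[of "\<lambda>n. s n * of_real r ^ n"] using T by simp
  hence "(\<lambda>n. s (Suc n) * of_real r ^ Suc n - of_real r * (s n * of_real r ^ n)) sums (T - s 0 - of_real r * T)"
    by (intro sums_diff sums_mult T)
  moreover have "s (Suc n) * of_real r ^ Suc n - of_real r * (s n * of_real r ^ n) = f (Suc n) * of_real r ^ Suc n" for n
    by (simp add: s_def ring_distribs)
  ultimately have "(\<lambda>n. f (Suc n) * of_real r ^ Suc n) sums (T - s 0 - of_real r * T)"
    by (simp only:)
  hence "(\<lambda>n. f n * of_real r ^ n) sums (T - s 0 - of_real r * T + f 0 * of_real r ^ 0)"
    by (simp only: sums_Suc_iff[of "\<lambda>n. f n * of_real r ^ n"])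
  hence "(\<lambda>n. f n * of_real r ^ n) sums (T - s 0 - of_real r * T + f 0)" by simp
  moreover have "T - s 0 - of_real r * T + f 0 = suminf f + (1 - of_real r) * T"
    by (simp add: s_def algebra_simps)
  ultimately show "(\<lambda>n. f n * of_real r ^ n) sums (suminf f + (1 - of_real r) * (\<Sum>n. s n * of_real r ^ n))"
    by (simp only: T_def)
qed

lemma Abel_limit_theorem:
  fixes f :: "nat \<Rightarrow> complex"
  assumes f: "summable f"
  shows "((\<lambda>r::real. \<Sum>n. f n * of_real r ^ n) \<longlongrightarrow> suminf f) (at_left 1)"
proof (rule tendstoI)
  fix e :: real assume "e > 0"
  define s where "s n = (\<Sum>k\<le>n. f k) - suminf f" for n
  have "s \<longlonglongrightarrow> suminf f - suminf f"
    unfolding s_def by (rule tendsto_diff[OF summable_LIMSEQ'[OF f] tendsto_const])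
  hence "eventually (\<lambda>n. norm (s n) < e / 2) sequentially"
    using tendstoD[of s 0 sequentially "e / 2"] \<open>e > 0\<close> by (simp add: dist_norm)
  then obtain N where N: "\<And>n. n \<ge> N \<Longrightarrow> norm (s n) < e / 2" by (auto simp: eventually_sequentially)
  define C where "C = (\<Sum>n<N. norm (s n))"
  have "((\<lambda>r::real. (1 - r) * C) \<longlongrightarrow> (1 - 1) * C) (at_left 1)" by (intro tendsto_intros)
  hence "eventually (\<lambda>r::real. (1 - r) * C < e / 2) (at_left 1)"
    using \<open>e > 0\<close> by (intro order_tendstoD(2)[of _ "(1 - 1) * C"]) auto
  moreover have "eventually (\<lambda>r::real. 0 < r \<and> r < 1) (at_left 1)"
    using eventually_at_left_real[of 0 "1::real"] by (simp add: greaterThanLessThan_iff)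
  ultimately show "eventually (\<lambda>r. dist (\<Sum>n. f n * of_real r ^ n) (suminf f) < e) (at_left (1::real))"
  proof eventually_elim
    case (elim r)
    hence r: "0 \<le> r" "r < 1" "0 < r" by auto
    have sn: "summable (\<lambda>n. norm (s n * of_real r ^ n))"
      and S: "(\<lambda>n. f n * of_real r ^ n) sums (suminf f + (1 - of_real r) * (\<Sum>n. s n * of_real r ^ n))"
      unfolding s_def by (rule Abel_summation_by_parts[OF f r(1,2)])+
    define d where "d n = (if n < N then norm (s n) else 0)" for n
    have d: "d sums C" unfolding C_def d_def using sums_finite[of "{..<N}" "\<lambda>n. if n < N then norm (s n) else 0"] by simp
    have g: "(\<lambda>n. e / 2 * r ^ n) sums (e / 2 * (1 / (1 - r)))"
      using r by (intro sums_mult geometric_sums) auto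
    have "norm (\<Sum>n. s n * of_real r ^ n) \<le> (\<Sum>n. norm (s n * of_real r ^ n))"
      by (rule summable_norm[OF sn])
    also have "\<dots> \<le> (\<Sum>n. d n + e / 2 * r ^ n)"
    proof (rule suminf_le)
      show "norm (s n * of_real r ^ n) \<le> d n + e / 2 * r ^ n" for n
      proof (cases "n < N")
        case True
        have "norm (s n) * r ^ n \<le> norm (s n) * 1"
          using r by (intro mult_left_mono power_le_one) auto
        moreover have "0 \<le> e / 2 * r ^ n" using \<open>e > 0\<close> r by simp
        ultimately show ?thesis using True r by (simp add: d_def norm_mult norm_power)
      next
        case False
        thus ?thesis using N[of n] r
          by (simp add: d_def norm_mult norm_power)
      qed
      show "summable (\<lambda>n. d n + e / 2 * r ^ n)" using sums_add[OF d g] by (rule sums_summable)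
    qed (rule sn)
    also have "\<dots> = C + e / 2 * (1 / (1 - r))" using sums_add[OF d g] by (rule sums_unique[symmetric])
    finally have "(1 - r) * norm (\<Sum>n. s n * of_real r ^ n) \<le> (1 - r) * (C + e / 2 * (1 / (1 - r)))"
      using r by (intro mult_left_mono) auto
    also have "\<dots> = (1 - r) * C + e / 2" using r by (simp add: field_simps)
    also have "\<dots> < e" using elim by simp
    finally have *: "(1 - r) * norm (\<Sum>n. s n * of_real r ^ n) < e" .
    have "dist (\<Sum>n. f n * of_real r ^ n) (suminf f) = norm ((1 - of_real r :: complex) * (\<Sum>n. s n * of_real r ^ n))"
      unfolding sums_unique[OF S, symmetric] dist_norm by simp
    also have "\<dots> = (1 - r) * norm (\<Sum>n. s n * of_real r ^ n)"
      using r by (simp add: norm_mult norm_one_minus_of_real)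
    finally show ?case using * by simp
  qed
qed

section \<open>Analytic continuation on annular sectors of the disc\<close>

text \<open>
  The common shape of the domains of the summation formulae: the region of convergence depends on the
  scaled arguments through \<open>norm (1 - s)\<close> only.  For positive \<open>p\<close>, \<open>q\<close> with \<open>p + q < 1\<close> it is the intersection of a disc
  about \<open>0\<close> with an open annulus about \<open>1\<close>; for \<open>p = 0 < q\<close> the annulus becomes the exterior of a disc.
\<close>
definition horn_lune :: "real \<Rightarrow> real \<Rightarrow> real \<Rightarrow> complex set" where
  "horn_lune p q r = {s. norm s < r \<and> p * norm (1 - s) + q / norm (1 - s) < 1}"

lemma open_horn_lune:
  assumes "r \<le> 1"
  shows "open (horn_lune p q r)"
proof -
  have "continuous_on (ball 0 r) (\<lambda>s::complex. p * norm (1 - s) + q / norm (1 - s))"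
    using assms by (intro continuous_intros) auto
  hence "open (ball 0 r \<inter> (\<lambda>s::complex. p * norm (1 - s) + q / norm (1 - s)) -` {..<1})"
    by (intro continuous_open_preimage) simp_all
  also have "ball 0 r \<inter> (\<lambda>s. p * norm (1 - s) + q / norm (1 - s)) -` {..<1} = horn_lune p q r"
    by (auto simp: horn_lune_def)
  finally show ?thesis .
qed

text \<open>
  The function \<open>p a + q / a\<close> is convex for \<open>a > 0\<close> and less than \<open>1\<close> at both endpoints.
\<close>
lemma horn_gauge_segment:
  fixes p q a :: real
  assumes "0 \<le> p" "0 \<le> q" "p + q < 1" "a > 0" "p * a + q / a < 1" "b \<in> closed_segment a 1"
  shows "p * b + q / b < 1"
proof -
  obtain u where u: "0 \<le> u" "u \<le> 1" "b = (1 - u) * a + u"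
    using assms(6) by (auto simp: in_segment)
  have b: "b > 0" using u assms(4) by (cases "u = 1") (auto intro: add_pos_nonneg)
  have "1 \<le> ((1 - u) / a + u) * b"
  proof -
    have "((1 - u) / a + u) * b - 1 = u * (1 - u) * (a - 1)^2 / a"
      using assms(4) unfolding u(3) by (simp add: field_simps power2_eq_square)
    also have "\<dots> \<ge> 0" using u assms(4) by simp
    finally show ?thesis by simp
  qed
  hence "1 / b \<le> (1 - u) / a + u" using b by (simp add: field_simps)
  hence "q * (1 / b) \<le> q * ((1 - u) / a + u)" using assms(2) by (rule mult_left_mono)
  hence "p * b + q / b \<le> (1 - u) * (p * a + q / a) + u * (p + q)"
    unfolding u(3) by (simp add: algebra_simps)
  also have "\<dots> < 1"
  proof (cases "u = 1")
    case False
    have "(1 - u) * (p * a + q / a) < (1 - u) * 1"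
      using False u assms by (intro mult_strict_left_mono) auto
    moreover have "u * (p + q) \<le> u * 1" using u assms by (intro mult_left_mono) auto
    ultimately show ?thesis by simp
  qed (use assms in auto)
  finally show ?thesis .
qed

text \<open>
  Every point is joined to \<open>0\<close> inside the set: first along the circle about \<open>1\<close> through the point, towards the
  real axis, which leaves \<open>norm (1 - s)\<close> fixed and does not increase \<open>norm s\<close>; then along the real axis, which
  stays in the set by \<open>horn_gauge_segment\<close>.
\<close>
lemma connected_horn_lune:
  assumes "0 \<le> p" "0 \<le> q" "p + q < 1" "r \<le> 1"
  shows "connected (horn_lune p q r)"
proof -
  have comp: "connected_component (horn_lune p q r) s 0" if s: "s \<in> horn_lune p q r" for s
  proof -
    define \<rho> where "\<rho> = norm (1 - s)"
    define \<theta> where "\<theta> = Arg (1 - s)"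
    have s1: "norm s < r" "p * \<rho> + q / \<rho> < 1" using s by (auto simp: horn_lune_def \<rho>_def)
    have "s \<noteq> 1" using s1 assms by auto
    hence \<rho>: "\<rho> > 0" by (simp add: \<rho>_def)
    have s_eq: "s = 1 - rcis \<rho> \<theta>"
      unfolding \<rho>_def \<theta>_def rcis_cmod_Arg by simp
    have n2: "norm (1 - rcis \<rho> \<phi>) ^ 2 = 1 + \<rho>^2 - 2 * \<rho> * cos \<phi>" for \<phi>
    proof -
      have "norm (1 - rcis \<rho> \<phi>) ^ 2 = (1 - \<rho> * cos \<phi>)^2 + (\<rho> * sin \<phi>)^2"
        unfolding cmod_power2 by simp
      also have "\<dots> = 1 - 2 * \<rho> * cos \<phi> + \<rho>^2 * ((sin \<phi>)^2 + (cos \<phi>)^2)"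
        by (simp only: power2_diff power_mult_distrib distrib_left) simp
      finally show ?thesis by (simp only: sin_cos_squared_add)
    qed
    define T1 where "T1 = (\<lambda>u. 1 - rcis \<rho> (u * \<theta>)) ` {0..1}"
    define T2 where "T2 = (\<lambda>x. 1 - complex_of_real x) ` closed_segment \<rho> 1"
    have "connected T1" unfolding T1_def rcis_def cis_conv_exp
      by (intro connected_continuous_image continuous_intros) auto
    moreover have "connected T2" unfolding T2_def
      by (intro connected_continuous_image continuous_intros) auto
    moreover have arc: "norm (1 - rcis \<rho> (u * \<theta>)) \<le> norm s" if u: "0 \<le> u" "u \<le> 1" for u
    proof -
      have "cos \<bar>\<theta>\<bar> \<le> cos \<bar>u * \<theta>\<bar>"
        using u Arg_bounded[of "1 - s"] unfolding \<theta>_def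
        by (intro cos_monotone_0_pi_le) (auto simp: abs_mult mult_left_le_one_le)
      hence "norm (1 - rcis \<rho> (u * \<theta>)) ^ 2 \<le> norm s ^ 2"
        unfolding s_eq n2 using \<rho> by simp
      thus ?thesis by (rule power2_le_imp_le) simp
    qed
    have "T1 \<subseteq> horn_lune p q r"
      using arc s1 \<rho> by (force simp: T1_def horn_lune_def)
    moreover have "T2 \<subseteq> horn_lune p q r"
    proof
      fix z assume "z \<in> T2"
      then obtain x where x: "x \<in> closed_segment \<rho> 1" "z = 1 - complex_of_real x"
        by (auto simp: T2_def)
      have xb: "\<bar>1 - x\<bar> \<le> \<bar>1 - \<rho>\<bar>" "x > 0"
        using x(1) \<rho> by (auto simp: closed_segment_eq_real_ivl split: if_splits)
      have "\<bar>1 - \<rho>\<bar> \<le> norm s"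
        using arc[of 0] by (simp add: rcis_def norm_one_minus_of_real)
      hence "norm z < r" using xb s1 x by (simp add: norm_one_minus_of_real)
      moreover have "p * x + q / x < 1"
        by (rule horn_gauge_segment[OF assms(1-3) \<rho> s1(2) x(1)])
      ultimately show "z \<in> horn_lune p q r" using xb x by (simp add: horn_lune_def)
    qed
    moreover have "s \<in> T1" "1 - complex_of_real \<rho> \<in> T1"
      unfolding T1_def by (rule image_eqI[of _ _ 1] image_eqI[of _ _ 0]; simp add: s_eq rcis_def)+
    moreover have "1 - complex_of_real \<rho> \<in> T2" "0 \<in> T2"
      unfolding T2_def by (rule image_eqI[of _ _ \<rho>] image_eqI[of _ _ 1]; simp)+
    ultimately show ?thesis
      by (intro connected_component_trans[of _ s "1 - complex_of_real \<rho>" 0])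
        (auto simp: connected_component_def)
  qed
  show ?thesis
    unfolding connected_iff_connected_component
    using comp by (meson connected_component_sym connected_component_trans)
qed

lemma power_series_coeffs_unique:
  fixes a b :: "nat \<Rightarrow> complex"
  assumes "0 < r"
    and "\<And>s. norm s < r \<Longrightarrow> (\<lambda>k. a k * s ^ k) sums h s"
    and "\<And>s. norm s < r \<Longrightarrow> (\<lambda>k. b k * s ^ k) sums h s"
  shows "a k = b k"
proof (rule ccontr)
  have d: "(\<lambda>k. (a k - b k) * s ^ k) sums 0" if "norm s < r" for s
    using sums_diff[OF assms(2,3)[OF that]] by (simp add: algebra_simps)
  assume "a k \<noteq> b k"
  moreover have "a 0 = b 0" using d[of 0] assms(1) by simp
  ultimately have "k > 0" by (cases k) auto
  obtain s where "s > 0" "\<And>z. z \<in> cball 0 s - {0::complex} \<Longrightarrow> (0::complex) \<noteq> 0"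
    by (rule powser_0_nonzero[of r 0 "\<lambda>k. a k - b k" "\<lambda>_. 0" k])
       (use d assms(1) \<open>a k \<noteq> b k\<close> \<open>k > 0\<close> in auto)
  from this(2)[of "of_real s"] \<open>s > 0\<close> show False by auto
qed

text \<open>
  A power series that represents a holomorphic function near \<open>0\<close> represents it at every point \<open>t\<close> of the lune
  at which it converges, and it converges if the closed disc about \<open>0\<close> through \<open>t\<close> lies in the lune.  The convergence may
  be conditional, with \<open>t\<close> on the circle of convergence; hence the limit along the radius.
\<close>
lemma power_series_on_horn_lune:
  fixes h :: "complex \<Rightarrow> complex" and a :: "nat \<Rightarrow> complex"
  assumes pq: "0 \<le> p" "0 \<le> q" "p + q < 1"
    and h: "h holomorphic_on horn_lune p q 1"
    and \<epsilon>: "\<epsilon> > 0" "\<And>s. norm s < \<epsilon> \<Longrightarrow> s \<in> horn_lune p q 1 \<Longrightarrow> (\<lambda>k. a k * s ^ k) sums h s"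
    and t: "t \<in> horn_lune p q 1"
  shows "summable (\<lambda>k. a k * t ^ k) \<Longrightarrow> h t = (\<Sum>k. a k * t ^ k)"
    and "(\<And>s. norm s \<le> norm t \<Longrightarrow> s \<in> horn_lune p q 1) \<Longrightarrow> summable (\<lambda>k. a k * t ^ k)"
proof -
  let ?U = "horn_lune p q 1"
  have U: "open ?U" by (rule open_horn_lune) simp
  have "0 \<in> ?U" using pq by (simp add: horn_lune_def)
  with U obtain \<delta> where \<delta>: "\<delta> > 0" "ball 0 \<delta> \<subseteq> ?U" by (auto simp: open_contains_ball)
  define \<eta> where "\<eta> = min \<epsilon> \<delta>"
  have \<eta>: "\<eta> > 0" using \<epsilon> \<delta> by (simp add: \<eta>_def)
  have loc: "(\<lambda>k. a k * s ^ k) sums h s" if "norm s < \<eta>" for s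
    using that \<delta> by (intro \<epsilon>) (auto simp: \<eta>_def)
  show "h t = (\<Sum>k. a k * t ^ k)" if sum: "summable (\<lambda>k. a k * t ^ k)"
  proof (cases "t = 0")
    case True
    thus ?thesis using loc[of 0] \<eta> by (auto dest!: sums_unique)
  next
    case False
    define V where "V = horn_lune p q (norm t)"
    have nt: "norm t > 0" "norm t < 1" using False t by (auto simp: horn_lune_def)
    have VU: "V \<subseteq> ?U" using nt by (auto simp: V_def horn_lune_def)
    define g where "g s = (\<Sum>k. a k * s ^ k)" for s
    have gs: "(\<lambda>k. a k * s ^ k) sums g s" if "norm s < norm t" for s
      unfolding g_def using powser_inside[OF sum that] by (rule summable_sums)
    have "g holomorphic_on ball 0 (norm t)"
      by (rule power_series_holomorphic[where a = a]) (use gs in auto)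
    hence gV: "g holomorphic_on V"
      by (rule holomorphic_on_subset) (auto simp: V_def horn_lune_def)
    have hg: "h z = g z" if "z \<in> V" for z
    proof (rule analytic_continuation_open[of "ball 0 (min \<eta> (norm t))" V h g z])
      show "open V" "connected V"
        using nt pq by (auto simp: V_def intro!: open_horn_lune connected_horn_lune)
      show "ball 0 (min \<eta> (norm t)) \<noteq> {}"
        using \<eta> nt by (auto simp: min_le_iff_disj)
      show "ball 0 (min \<eta> (norm t)) \<subseteq> V"
        using \<delta> by (auto simp: V_def horn_lune_def \<eta>_def subset_iff)
      show "h holomorphic_on V" using h VU by (rule holomorphic_on_subset)
      show "h s = g s" if "s \<in> ball 0 (min \<eta> (norm t))" for s
        using loc[of s] gs[of s] that by (auto dest: sums_unique2)
    qed (use gV that in auto)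
    have path: "((\<lambda>r::real. of_real r * t) \<longlongrightarrow> of_real 1 * t) (at_left 1)"
      by (intro tendsto_intros)
    have "isCont h t"
      using h U t by (meson continuous_on_eq_continuous_at holomorphic_on_imp_continuous_on)
    hence h_lim: "((\<lambda>r::real. h (of_real r * t)) \<longlongrightarrow> h t) (at_left 1)"
      using path by (intro isCont_tendsto_compose[of t h]) auto
    have "eventually (\<lambda>r::real. of_real r * t \<in> ?U) (at_left 1)"
      using path U t by (intro topological_tendstoD) auto
    moreover have "eventually (\<lambda>r::real. 0 < r \<and> r < 1) (at_left 1)"
      using eventually_at_left_real[of 0 "1::real"] by (simp add: greaterThanLessThan_iff)
    ultimately have "eventually (\<lambda>r::real. h (of_real r * t) = (\<Sum>k. a k * t ^ k * of_real r ^ k)) (at_left 1)"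
    proof eventually_elim
      case (elim r)
      hence "of_real r * t \<in> V" using nt
        by (auto simp: V_def horn_lune_def norm_mult)
      hence "h (of_real r * t) = g (of_real r * t)" by (rule hg)
      thus ?case by (simp add: g_def power_mult_distrib mult_ac)
    qed
    with h_lim have "((\<lambda>r::real. \<Sum>k. a k * t ^ k * of_real r ^ k) \<longlongrightarrow> h t) (at_left 1)"
      by (rule Lim_transform_eventually)
    moreover note Abel_limit_theorem[OF sum]
    ultimately show ?thesis by (rule tendsto_unique[rotated]) simp
  qed
  show "summable (\<lambda>k. a k * t ^ k)" if disc: "\<And>s. norm s \<le> norm t \<Longrightarrow> s \<in> ?U"
  proof -
    have "cball 0 (norm t) \<subseteq> ?U" using disc by auto
    then obtain e where e: "e > 0" "(\<Union>x\<in>cball 0 (norm t). ball x e) \<subseteq> ?U"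
      using compact_subset_open_imp_ball_epsilon_subset[OF compact_cball U] by blast
    have sub: "ball 0 (norm t + e) \<subseteq> ?U"
    proof
      fix s :: complex assume s: "s \<in> ball 0 (norm t + e)"
      show "s \<in> ?U"
      proof (cases "norm s \<le> norm t")
        case False
        \<comment> \<open>the point of the closed disc nearest to \<open>s\<close>\<close>
        define x where "x = of_real (norm t / norm s) * s"
        have ns: "norm s > 0" using False by (meson norm_ge_zero not_le order_le_less_trans)
        have "norm x = norm t" using ns by (simp add: x_def norm_mult norm_divide)
        moreover have "dist x s < e"
        proof -
          have "x - s = of_real (norm t / norm s - 1) * s" by (simp add: x_def algebra_simps)
          hence "dist x s = \<bar>norm t / norm s - 1\<bar> * norm s"
            by (simp only: dist_norm norm_mult norm_of_real)
          also have "\<dots> = norm s - norm t" using ns False by (simp add: field_simps abs_if)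
          finally show ?thesis using s by simp
        qed
        ultimately have "s \<in> (\<Union>x\<in>cball 0 (norm t). ball x e)" by force
        thus ?thesis using e(2) by blast
      qed (rule disc)
    qed
    define b where "b k = (deriv ^^ k) h 0 / fact k" for k
    have hb: "(\<lambda>k. b k * s ^ k) sums h s" if "norm s < norm t + e" for s
      using holomorphic_power_series[OF holomorphic_on_subset[OF h sub], of s] that
      by (simp add: b_def)
    have "a k = b k" for k
      by (rule power_series_coeffs_unique[of "min \<eta> (norm t + e)" a h b])
         (use \<eta> e loc hb in \<open>auto intro: add_nonneg_pos\<close>)
    thus ?thesis using hb[of t] e(1) by (auto simp: sums_iff)
  qed
qed

section \<open>Convergence and holomorphy of the Horn function\<close>

definition horn_term ::
  "complex^'d^'d \<Rightarrow> complex^'d^'d \<Rightarrow> complex^'d^'d \<Rightarrow> complex \<Rightarrow> complex \<Rightarrow> nat \<times> nat \<Rightarrow> complex^'d^'d"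
  where "horn_term A B B' x y = (\<lambda>(m, n). cscale (x ^ m * y ^ n / (fact m * fact n))
     (mpoch_nat A (m + n) ** mpoch B (int n - int m) ** mpoch B' (int m - int n)))"

lemma Horn_G1_eq: "Horn_G1 A B B' x y = infsum (horn_term A B B' x y) UNIV"
  by (simp add: Horn_G1_def horn_term_def)

lemma horn_majorant_mono:
  assumes "0 \<le> X" "X \<le> X'" "0 \<le> Y" "Y \<le> Y'"
  shows "horn_majorant A B B' X Y p \<le> horn_majorant A B B' X' Y' p"
  unfolding horn_majorant_def using assms
  by (auto split: prod.split intro!: mult_right_mono divide_right_mono mult_mono power_mono mult_nonneg_nonneg)

lemma opnorm_horn_coefficient:
  fixes x y :: complex
  shows
  "norm (x ^ m * y ^ n / (fact m * fact n)) * (opnorm (mpoch_nat A (m + n)) *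
     (opnorm (mpoch B (int n - int m)) * opnorm (mpoch B' (int m - int n)))) =
   horn_majorant A B B' (norm x) (norm y) (m, n)"
  by (simp add: horn_majorant_def norm_mult norm_divide norm_power norm_fact)

lemma opnorm_horn_term: "opnorm (horn_term A B B' x y p) \<le> horn_majorant A B B' (norm x) (norm y) p"
proof (cases p)
  case (Pair m n)
  have "opnorm (mpoch_nat A (m + n) ** mpoch B (int n - int m) ** mpoch B' (int m - int n)) \<le>
     opnorm (mpoch_nat A (m + n)) * (opnorm (mpoch B (int n - int m)) * opnorm (mpoch B' (int m - int n)))"
    unfolding matrix_mul_assoc[symmetric]
    by (intro order_trans[OF opnorm_mult] mult_left_mono opnorm_mult) auto
  thus ?thesis unfolding Pair horn_term_def prod.case opnorm_horn_coefficient[symmetric]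
    by (intro order_trans[OF opnorm_cscale] mult_left_mono) auto
qed

lemma horn_majorant_summable_on:
  assumes "mpoch_defined B" "mpoch_defined B'" "0 \<le> X" "0 \<le> Y" "X + Y < 1"
  shows "horn_majorant A B B' X Y summable_on UNIV"
proof -
  obtain \<rho> where \<rho>: "\<rho> > 1"
    "(\<lambda>(m, n). horn_majorant A B B' X Y (m, n) * \<rho> ^ (m + n)) summable_on UNIV"
    using horn_majorant_summable[OF assms] by blast
  have nn: "0 \<le> horn_majorant A B B' X Y p" for p
    using assms by (auto simp: horn_majorant_def split: prod.split)
  have "(\<lambda>p. norm (horn_majorant A B B' X Y p)) summable_on UNIV"
  proof (rule Infinite_Sum.abs_summable_on_comparison_test'[OF \<rho>(2)])
    fix p :: "nat \<times> nat"
    show "norm (horn_majorant A B B' X Y p) \<le> (case p of (m, n) \<Rightarrow> horn_majorant A B B' X Y (m, n) * \<rho> ^ (m + n))"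
      using mult_left_mono[OF one_le_power[of \<rho> "fst p + snd p"] nn[of p]] nn[of p] \<rho>(1)
      by (auto split: prod.split)
  qed
  thus ?thesis by (rule abs_summable_summable)
qed

lemma horn_term_summable:
  assumes "mpoch_defined B" "mpoch_defined B'" "Horn_G1_region x y"
  shows "horn_term A B B' x y summable_on UNIV"
  using assms unfolding Horn_G1_region_def
  by (intro summable_on_if_opnorm_le(2)[OF horn_majorant_summable_on[of B B' "norm x" "norm y" A]]
      opnorm_horn_term) auto

text \<open>
  Near each point the norms of the arguments stay below some \<open>X\<close> and \<open>Y\<close> with \<open>X + Y < 1\<close>, so the double series
  converges uniformly there, by the Weierstrass test with the majorant at \<open>X\<close> and \<open>Y\<close>.
\<close>
lemma Horn_G1_entry_holomorphic:
  fixes A B B' :: "complex^'d^'d"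
  assumes BB': "mpoch_defined B" "mpoch_defined B'" and S: "open S"
    and \<phi>: "\<phi> holomorphic_on S" and \<psi>: "\<psi> holomorphic_on S"
    and reg: "\<And>s. s \<in> S \<Longrightarrow> Horn_G1_region (\<phi> s) (\<psi> s)"
  shows "(\<lambda>s. Horn_G1 A B B' (\<phi> s) (\<psi> s) $ i $ j) holomorphic_on S"
proof -
  let ?h = "\<lambda>s. Horn_G1 A B B' (\<phi> s) (\<psi> s) $ i $ j"
  have "\<exists>r>0. ball z r \<subseteq> S \<and> ?h holomorphic_on ball z r" if z: "z \<in> S" for z
  proof -
    define \<epsilon> where "\<epsilon> = (1 - (norm (\<phi> z) + norm (\<psi> z))) / 4"
    define X where "X = norm (\<phi> z) + \<epsilon>"
    define Y where "Y = norm (\<psi> z) + \<epsilon>"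
    have \<epsilon>: "\<epsilon> > 0" using reg[OF z] by (simp add: \<epsilon>_def Horn_G1_region_def)
    have XY: "0 \<le> X" "0 \<le> Y" "X + Y < 1"
      using \<epsilon> by (auto simp: X_def Y_def) (simp add: \<epsilon>_def field_simps)
    have "isCont \<phi> z" "isCont \<psi> z"
      using z S \<phi> \<psi> by (meson continuous_on_eq_continuous_at holomorphic_on_imp_continuous_on)+
    hence "((\<lambda>w. norm (\<phi> w)) \<longlongrightarrow> norm (\<phi> z)) (nhds z)" "((\<lambda>w. norm (\<psi> w)) \<longlongrightarrow> norm (\<psi> z)) (nhds z)"
      by (auto simp: isCont_def tendsto_at_iff_tendsto_nhds intro!: tendsto_norm)
    hence "eventually (\<lambda>w. norm (\<phi> w) < X) (nhds z)" "eventually (\<lambda>w. norm (\<psi> w) < Y) (nhds z)"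
      using \<epsilon> by (auto simp: X_def Y_def dest!: order_tendstoD(2))
    moreover have "eventually (\<lambda>w. w \<in> S) (nhds z)" using S z by (simp add: eventually_nhds_in_open)
    ultimately have "eventually (\<lambda>w. norm (\<phi> w) < X \<and> norm (\<psi> w) < Y \<and> w \<in> S) (nhds z)"
      by eventually_elim auto
    then obtain d where d: "d > 0" "\<And>w. dist w z < d \<Longrightarrow> norm (\<phi> w) < X \<and> norm (\<psi> w) < Y \<and> w \<in> S"
      by (auto simp: eventually_nhds_metric)
    define r where "r = d / 2"
    have r: "r > 0" "\<And>w. w \<in> cball z r \<Longrightarrow> norm (\<phi> w) < X \<and> norm (\<psi> w) < Y \<and> w \<in> S"
      using d by (auto simp: r_def dist_commute)
    let ?f = "\<lambda>p w. horn_term A B B' (\<phi> w) (\<psi> w) p $ i $ j"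
    have ul: "uniform_limit (cball z r) (\<lambda>F w. \<Sum>p\<in>F. ?f p w) (\<lambda>w. \<Sum>\<^sub>\<infinity>p. ?f p w) (finite_subsets_at_top UNIV)"
    proof (rule Weierstrass_m_test_general)
      show "norm (?f p w) \<le> horn_majorant A B B' X Y p" if "w \<in> cball z r" for p w
        using r(2)[OF that] by (intro order_trans[OF entry_le_opnorm] order_trans[OF opnorm_horn_term]
            horn_majorant_mono) auto
      show "horn_majorant A B B' X Y summable_on UNIV"
        by (rule horn_majorant_summable_on[OF BB' XY])
    qed
    have hol: "?f p holomorphic_on cball z r" for p
    proof -
      have "\<phi> holomorphic_on cball z r" "\<psi> holomorphic_on cball z r"
        using \<phi> \<psi> r(2) by (auto intro: holomorphic_on_subset)
      thus ?thesis by (cases p) (auto simp: horn_term_def intro!: holomorphic_intros)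
    qed
    have "(\<lambda>w. \<Sum>\<^sub>\<infinity>p. ?f p w) holomorphic_on ball z r"
    proof (rule holomorphic_uniform_limit[OF _ ul])
      show "\<forall>\<^sub>F F in finite_subsets_at_top UNIV. continuous_on (cball z r) (\<lambda>w. \<Sum>p\<in>F. ?f p w) \<and>
          (\<lambda>w. \<Sum>p\<in>F. ?f p w) holomorphic_on ball z r"
        using hol by (intro always_eventually allI conjI holomorphic_on_imp_continuous_on holomorphic_on_sum)
          (auto intro: holomorphic_on_subset[OF hol ball_subset_cball])
    qed auto
    moreover have "(\<Sum>\<^sub>\<infinity>p. ?f p w) = ?h w" if "w \<in> ball z r" for w
    proof -
      have "horn_term A B B' (\<phi> w) (\<psi> w) summable_on UNIV"
        using r(2)[of w] that by (intro horn_term_summable BB' reg) auto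
      thus ?thesis unfolding Horn_G1_eq
        by (intro infsumI has_sum_bounded_linear[OF bounded_linear_entry] has_sum_infsum)
    qed
    ultimately have "?h holomorphic_on ball z r" by (rule holomorphic_transform)
    moreover have "ball z r \<subseteq> S" using r(2) by auto
    ultimately show ?thesis using r(1) by blast
  qed
  hence "?h analytic_on S" unfolding analytic_on_def by blast
  thus ?thesis by (rule analytic_imp_holomorphic)
qed

lemma one_minus_mpow_neg_entry_holomorphic:
  "(\<lambda>s. one_minus_mpow_neg s M $ i $ j) holomorphic_on ball 0 1"
proof (rule power_series_holomorphic)
  fix s :: complex assume "s \<in> ball 0 1"
  hence "(\<lambda>k. cscale (s ^ k / fact k) (mpoch_nat M k)) sums one_minus_mpow_neg s M"
    by (intro one_minus_mpow_neg_sums) simp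
  hence "(\<lambda>k. cscale (s ^ k / fact k) (mpoch_nat M k) $ i $ j) sums (one_minus_mpow_neg s M $ i $ j)"
    by (simp add: matrix_sums_iff)
  thus "(\<lambda>k. mpoch_nat M k $ i $ j / fact k * (s - 0) ^ k) sums (one_minus_mpow_neg s M $ i $ j)"
    by (simp add: mult_ac)
qed

lemma matrix_mult_holomorphic:
  assumes "\<And>i j. (\<lambda>s. F s $ i $ j) holomorphic_on S" "\<And>i j. (\<lambda>s. G s $ i $ j) holomorphic_on S"
  shows "(\<lambda>s. (F s ** G s) $ i $ j) holomorphic_on S"
  unfolding matrix_matrix_mult_def using assms by (auto intro!: holomorphic_intros)

text \<open>
  The statement \<open>power_series_on_horn_lune\<close>, applied to each matrix entry.
\<close>
lemma matrix_power_series_on_horn_lune: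
  fixes H :: "complex \<Rightarrow> complex^'d^'d" and W :: "nat \<Rightarrow> complex^'d^'d"
  assumes pq: "0 \<le> p" "0 \<le> q" "p + q < 1"
    and H: "\<And>i j. (\<lambda>s. H s $ i $ j) holomorphic_on horn_lune p q 1"
    and \<epsilon>: "\<epsilon> > 0"
    and loc: "\<And>s. norm s < \<epsilon> \<Longrightarrow> s \<in> horn_lune p q 1 \<Longrightarrow> (\<lambda>k. cscale (s ^ k / fact k) (W k)) sums H s"
    and t: "t \<in> horn_lune p q 1"
  shows "summable (\<lambda>k. cscale (t ^ k / fact k) (W k)) \<Longrightarrow> H t = (\<Sum>k. cscale (t ^ k / fact k) (W k))"
    and "(\<And>s. norm s \<le> norm t \<Longrightarrow> s \<in> horn_lune p q 1) \<Longrightarrow> summable (\<lambda>k. cscale (t ^ k / fact k) (W k))"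
proof -
  have entry: "cscale (s ^ k / fact k) (W k) $ i $ j = W k $ i $ j / fact k * s ^ k" for s k i j
    by simp
  have locij: "(\<lambda>k. W k $ i $ j / fact k * s ^ k) sums (H s $ i $ j)"
    if "norm s < \<epsilon>" "s \<in> horn_lune p q 1" for s i j
    using loc[OF that] unfolding matrix_sums_iff entry by blast
  note core = power_series_on_horn_lune[OF pq H \<epsilon> _ t]
  show "H t = (\<Sum>k. cscale (t ^ k / fact k) (W k))" if sum: "summable (\<lambda>k. cscale (t ^ k / fact k) (W k))"
  proof (rule sums_unique)
    obtain S where S: "(\<lambda>k. cscale (t ^ k / fact k) (W k)) sums S" using sum by (auto simp: summable_def)
    hence Sij: "(\<lambda>k. W k $ i $ j / fact k * t ^ k) sums (S $ i $ j)" for i j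
      unfolding matrix_sums_iff entry by blast
    have "H t $ i $ j = S $ i $ j" for i j
    proof -
      have "H t $ i $ j = (\<Sum>k. W k $ i $ j / fact k * t ^ k)"
        by (rule core(1)[OF locij]) (use Sij[of i j] in \<open>auto simp: sums_iff\<close>)
      thus ?thesis using Sij[of i j] by (simp add: sums_iff)
    qed
    hence "H t = S" by (simp add: vec_eq_iff)
    with S show "(\<lambda>k. cscale (t ^ k / fact k) (W k)) sums H t" by simp
  qed
  show "summable (\<lambda>k. cscale (t ^ k / fact k) (W k))" if "\<And>s. norm s \<le> norm t \<Longrightarrow> s \<in> horn_lune p q 1"
  proof -
    have "summable (\<lambda>k. W k $ i $ j / fact k * t ^ k)" for i j
      by (rule core(2)[OF locij]) (use that in auto)
    hence "(\<lambda>k. cscale (t ^ k / fact k) (W k)) sums (\<chi> i j. \<Sum>k. W k $ i $ j / fact k * t ^ k)"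
      unfolding matrix_sums_iff entry by (simp add: summable_sums)
    thus ?thesis by (rule sums_summable)
  qed
qed

section \<open>Expansion of the scaled Horn function near zero\<close>

text \<open>
  For the first formula \<open>L\<close> is the symbol of \<open>A\<close> and \<open>R\<close> the other two, so that the matrix power of \<open>A\<close>
  acts between them; for the third \<open>L\<close> is the whole term and \<open>R\<close> the identity.
  The surplus factor \<open>\<rho>\<close> in \<open>horn_majorant_summable\<close> pays for the matrix powers while \<open>norm s < 1 - 1 / \<rho>\<close>.
\<close>
lemma horn_expansion_local:
  fixes A B B' M :: "complex^'d^'d" and L R :: "nat \<times> nat \<Rightarrow> complex^'d^'d"
  assumes "mpoch_defined B" "mpoch_defined B'" "Horn_G1_region x y"
    and LR: "\<And>p. opnorm (L p) * opnorm (R p) \<le> horn_majorant A B B' (norm x) (norm y) p"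
    and l: "\<And>p. \<bar>l p\<bar> \<le> int (fst p + snd p)"
  shows "\<exists>\<epsilon>>0. \<forall>s. norm s < \<epsilon> \<longrightarrow>
     (\<lambda>k. cscale (s ^ k / fact k) (\<Sum>\<^sub>\<infinity>p. L p ** mpoch_nat (M + mat (of_int (l p))) k ** R p)) sums
     (\<Sum>\<^sub>\<infinity>p. L p ** one_minus_mpow_neg s (M + mat (of_int (l p))) ** R p)"
proof -
  obtain \<rho> where \<rho>: "\<rho> > 1"
    "(\<lambda>p. horn_majorant A B B' (norm x) (norm y) p * \<rho> ^ (fst p + snd p)) summable_on UNIV"
    using horn_majorant_summable[OF assms(1,2), of "norm x" "norm y" A] assms(3)
    by (auto simp: Horn_G1_region_def case_prod_unfold)
  have "(\<lambda>p. norm (opnorm (L p) * opnorm (R p) * \<rho> ^ nat \<bar>l p\<bar>)) summable_on UNIV"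
  proof (rule Infinite_Sum.abs_summable_on_comparison_test'[OF \<rho>(2)])
    fix p
    have "nat \<bar>l p\<bar> \<le> fst p + snd p" using l[of p] by linarith
    hence "\<rho> ^ nat \<bar>l p\<bar> \<le> \<rho> ^ (fst p + snd p)" using \<rho>(1) by (intro power_increasing) auto
    hence "opnorm (L p) * opnorm (R p) * \<rho> ^ nat \<bar>l p\<bar> \<le>
        horn_majorant A B B' (norm x) (norm y) p * \<rho> ^ (fst p + snd p)"
      using \<rho>(1) by (intro mult_mono LR order_trans[OF _ LR]) auto
    thus "norm (opnorm (L p) * opnorm (R p) * \<rho> ^ nat \<bar>l p\<bar>) \<le>
        horn_majorant A B B' (norm x) (norm y) p * \<rho> ^ (fst p + snd p)"
      using \<rho>(1) by (simp add: abs_mult)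
  qed
  hence "(\<lambda>p. opnorm (L p) * opnorm (R p) * \<rho> ^ nat \<bar>l p\<bar>) summable_on UNIV"
    by (rule abs_summable_summable)
  note inter = binomial_series_interchange[OF this \<rho>(1)]
  show ?thesis
    using \<rho>(1) by (intro exI[of _ "1 - 1 / \<rho>"] conjI allI impI inter) auto
qed

text \<open>
  The matrix power of \<open>A\<close> commutes past \<open>(A)\<^sub>m\<^sub>+\<^sub>n\<close> and absorbs \<open>(1 - s)\<^sup>-\<^sup>(\<^sup>m\<^sup>+\<^sup>n\<^sup>)\<close>.  The coefficients are identified
  by \<open>(A)\<^sub>m\<^sub>+\<^sub>n (A + (m + n))\<^sub>k = (A)\<^sub>k (A + k)\<^sub>m\<^sub>+\<^sub>n\<close>.
\<close>
lemma Horn_G1_shift_A_expansion: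
  fixes A B B' :: "complex^'d^'d"
  assumes BB': "mpoch_defined B" "mpoch_defined B'" and reg: "Horn_G1_region x y"
  shows "\<exists>\<epsilon>>0. \<forall>s. norm s < \<epsilon> \<longrightarrow> norm s < 1 \<longrightarrow> Horn_G1_region (x / (1 - s)) (y / (1 - s)) \<longrightarrow>
    (\<lambda>k. cscale (s ^ k / fact k) (mpoch_nat A k ** Horn_G1 (A + mat (of_nat k)) B B' x y)) sums
    (one_minus_mpow_neg s A ** Horn_G1 A B B' (x / (1 - s)) (y / (1 - s)))"
proof -
  define L where "L = (\<lambda>(m, n). cscale (x ^ m * y ^ n / (fact m * fact n)) (mpoch_nat A (m + n)))"
  define R where "R = (\<lambda>(m, n). mpoch B (int n - int m) ** mpoch B' (int m - int n))"
  define l where "l = (\<lambda>(m, n). int m + int n)"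
  have LR: "opnorm (L p) * opnorm (R p) \<le> horn_majorant A B B' (norm x) (norm y) p" for p
  proof (cases p)
    case (Pair m n)
    have "opnorm (L p) * opnorm (R p) \<le>
        (norm (x ^ m * y ^ n / (fact m * fact n)) * opnorm (mpoch_nat A (m + n))) *
        (opnorm (mpoch B (int n - int m)) * opnorm (mpoch B' (int m - int n)))"
      unfolding Pair L_def R_def prod.case
      by (intro mult_mono opnorm_cscale opnorm_mult) auto
    thus ?thesis unfolding Pair opnorm_horn_coefficient[symmetric] by (simp only: mult.assoc)
  qed
  have l: "\<bar>l p\<bar> \<le> int (fst p + snd p)" for p by (auto simp: l_def split: prod.split)
  obtain \<epsilon> where \<epsilon>: "\<epsilon> > 0" "\<And>s. norm s < \<epsilon> \<Longrightarrow>
     (\<lambda>k. cscale (s ^ k / fact k) (\<Sum>\<^sub>\<infinity>p. L p ** mpoch_nat (A + mat (of_int (l p))) k ** R p)) sums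
     (\<Sum>\<^sub>\<infinity>p. L p ** one_minus_mpow_neg s (A + mat (of_int (l p))) ** R p)"
    using horn_expansion_local[OF BB' reg LR l, of A] by blast
  have coeff: "(\<Sum>\<^sub>\<infinity>p. L p ** mpoch_nat (A + mat (of_int (l p))) k ** R p) =
      mpoch_nat A k ** Horn_G1 (A + mat (of_nat k)) B B' x y" for k
  proof -
    have "L p ** mpoch_nat (A + mat (of_int (l p))) k ** R p =
        mpoch_nat A k ** horn_term (A + mat (of_nat k)) B B' x y p" for p
    proof (cases p)
      case (Pair m n)
      have "mpoch_nat A (m + n) ** mpoch_nat (A + mat (of_nat (m + n))) k =
            mpoch_nat A k ** mpoch_nat (A + mat (of_nat k)) (m + n)"
        by (metis mpoch_nat_add add.commute)
      thus ?thesis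
        by (simp add: Pair L_def R_def l_def horn_term_def cscale_mult_left cscale_mult_right
            matrix_mul_assoc)
    qed
    thus ?thesis unfolding Horn_G1_eq
      by (simp add: infsum_matrix_mult_left horn_term_summable[OF BB' reg])
  qed
  have at_s: "(\<Sum>\<^sub>\<infinity>p. L p ** one_minus_mpow_neg s (A + mat (of_int (l p))) ** R p) =
      one_minus_mpow_neg s A ** Horn_G1 A B B' (x / (1 - s)) (y / (1 - s))"
    if s: "norm s < 1" and regs: "Horn_G1_region (x / (1 - s)) (y / (1 - s))" for s
  proof -
    have "L p ** one_minus_mpow_neg s (A + mat (of_int (l p))) ** R p =
        one_minus_mpow_neg s A ** horn_term A B B' (x / (1 - s)) (y / (1 - s)) p" for p
    proof (cases p)
      case (Pair m n)
      have "(1 - s) powi (- (int m + int n)) = 1 / ((1 - s) ^ m * (1 - s) ^ n)"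
        by (simp add: power_int_minus power_add inverse_eq_divide flip: of_nat_add)
      hence P: "one_minus_mpow_neg s (A + mat (of_int (l p))) =
          cscale (1 / ((1 - s) ^ m * (1 - s) ^ n)) (one_minus_mpow_neg s A)"
        unfolding one_minus_mpow_neg_shift[OF s] by (simp only: l_def Pair prod.case)
      have comm: "mpoch_nat A (m + n) ** one_minus_mpow_neg s A = one_minus_mpow_neg s A ** mpoch_nat A (m + n)"
        by (intro one_minus_mpow_neg_commute[OF s] commute_mpoch_nat[symmetric]) simp
      show ?thesis unfolding P
        by (simp add: Pair L_def R_def horn_term_def cscale_mult_left cscale_mult_right
            matrix_mul_assoc comm power_divide mult_ac)
    qed
    thus ?thesis unfolding Horn_G1_eq
      by (simp add: infsum_matrix_mult_left horn_term_summable[OF BB' regs])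
  qed
  show ?thesis
  proof (intro exI[of _ \<epsilon>] conjI allI impI)
    fix s assume "norm s < \<epsilon>" "norm s < 1" "Horn_G1_region (x / (1 - s)) (y / (1 - s))"
    thus "(\<lambda>k. cscale (s ^ k / fact k) (mpoch_nat A k ** Horn_G1 (A + mat (of_nat k)) B B' x y)) sums
      (one_minus_mpow_neg s A ** Horn_G1 A B B' (x / (1 - s)) (y / (1 - s)))"
      using \<epsilon>(2)[of s] at_s[of s] unfolding coeff by simp
  qed (rule \<epsilon>(1))
qed

text \<open>
  The symbol of \<open>B'\<close> is the last factor of the term, so the matrix power of \<open>B'\<close> on the right meets it directly.
  The coefficients are identified by \<open>mpoch_shift_exchange\<close> with \<open>l = m - n\<close>.
\<close>
lemma Horn_G1_shift_B'_expansion: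
  fixes A B B' :: "complex^'d^'d"
  assumes BB': "mpoch_defined B" "\<And>k. mpoch_defined (B' + mat (of_nat k))" and reg: "Horn_G1_region x y"
  shows "\<exists>\<epsilon>>0. \<forall>s. norm s < \<epsilon> \<longrightarrow> norm s < 1 \<longrightarrow> Horn_G1_region (x / (1 - s)) (y * (1 - s)) \<longrightarrow>
    (\<lambda>k. cscale (s ^ k / fact k) (Horn_G1 A B (B' + mat (of_nat k)) x y ** mpoch_nat B' k)) sums
    (Horn_G1 A B B' (x / (1 - s)) (y * (1 - s)) ** one_minus_mpow_neg s B')"
proof -
  have B': "mpoch_defined B'" using BB'(2)[of 0] by (simp add: mat_def flip: zero_vec_def)
  define l where "l = (\<lambda>(m, n). int m - int n)"
  let ?L = "horn_term A B B' x y" and ?R = "\<lambda>p::nat\<times>nat. mat 1 :: complex^'d^'d"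
  have LR: "opnorm (?L p) * opnorm (?R p) \<le> horn_majorant A B B' (norm x) (norm y) p" for p
    using mult_mono[OF opnorm_horn_term[of A B B' x y p] opnorm_one[where 'a='d]]
      order_trans[OF opnorm_nonneg opnorm_horn_term[of A B B' x y p]] by simp
  have l: "\<bar>l p\<bar> \<le> int (fst p + snd p)" for p by (auto simp: l_def split: prod.split)
  obtain \<epsilon> where \<epsilon>: "\<epsilon> > 0" "\<And>s. norm s < \<epsilon> \<Longrightarrow>
     (\<lambda>k. cscale (s ^ k / fact k) (\<Sum>\<^sub>\<infinity>p. ?L p ** mpoch_nat (B' + mat (of_int (l p))) k ** ?R p)) sums
     (\<Sum>\<^sub>\<infinity>p. ?L p ** one_minus_mpow_neg s (B' + mat (of_int (l p))) ** ?R p)"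
    using horn_expansion_local[OF BB'(1) B' reg LR l, of B'] by blast
  have coeff: "(\<Sum>\<^sub>\<infinity>p. ?L p ** mpoch_nat (B' + mat (of_int (l p))) k ** ?R p) =
      Horn_G1 A B (B' + mat (of_nat k)) x y ** mpoch_nat B' k" for k
  proof -
    have "?L p ** mpoch_nat (B' + mat (of_int (l p))) k ** ?R p =
        horn_term A B (B' + mat (of_nat k)) x y p ** mpoch_nat B' k" for p
    proof (cases p)
      case (Pair m n)
      note mpoch_shift_exchange[OF B' BB'(2)[of k], of "int m - int n"]
      thus ?thesis
        by (simp add: Pair l_def horn_term_def cscale_mult_left flip: matrix_mul_assoc)
    qed
    thus ?thesis unfolding Horn_G1_eq
      by (simp add: infsum_matrix_mult_right horn_term_summable[OF BB'(1) BB'(2) reg])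
  qed
  have at_s: "(\<Sum>\<^sub>\<infinity>p. ?L p ** one_minus_mpow_neg s (B' + mat (of_int (l p))) ** ?R p) =
      Horn_G1 A B B' (x / (1 - s)) (y * (1 - s)) ** one_minus_mpow_neg s B'"
    if s: "norm s < 1" and regs: "Horn_G1_region (x / (1 - s)) (y * (1 - s))" for s
  proof -
    have "?L p ** one_minus_mpow_neg s (B' + mat (of_int (l p))) ** ?R p =
        horn_term A B B' (x / (1 - s)) (y * (1 - s)) p ** one_minus_mpow_neg s B'" for p
    proof (cases p)
      case (Pair m n)
      have "1 - s \<noteq> 0" using s by auto
      hence "(1 - s) powi (int n - int m) = (1 - s) ^ n / (1 - s) ^ m"
        by (simp add: power_int_diff)
      hence P: "one_minus_mpow_neg s (B' + mat (of_int (l p))) =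
          cscale ((1 - s) ^ n / (1 - s) ^ m) (one_minus_mpow_neg s B')"
        unfolding one_minus_mpow_neg_shift[OF s] by (simp add: l_def Pair)
      show ?thesis unfolding P
        by (simp add: Pair horn_term_def cscale_mult_left cscale_mult_right
            power_divide power_mult_distrib mult_ac)
    qed
    thus ?thesis unfolding Horn_G1_eq
      by (simp add: infsum_matrix_mult_right horn_term_summable[OF BB'(1) B' regs])
  qed
  show ?thesis
  proof (intro exI[of _ \<epsilon>] conjI allI impI)
    fix s assume "norm s < \<epsilon>" "norm s < 1" "Horn_G1_region (x / (1 - s)) (y * (1 - s))"
    thus "(\<lambda>k. cscale (s ^ k / fact k) (Horn_G1 A B (B' + mat (of_nat k)) x y ** mpoch_nat B' k)) sums
      (Horn_G1 A B B' (x / (1 - s)) (y * (1 - s)) ** one_minus_mpow_neg s B')"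
      using \<epsilon>(2)[of s] at_s[of s] unfolding coeff by simp
  qed (rule \<epsilon>(1))
qed

section \<open>The summation formulae\<close>

lemma mem_horn_lune_A: "s \<in> horn_lune 0 (norm x + norm y) 1 \<longleftrightarrow>
   norm s < 1 \<and> Horn_G1_region (x / (1 - s)) (y / (1 - s))"
  by (simp add: horn_lune_def Horn_G1_region_def norm_divide add_divide_distrib)

lemma mem_horn_lune_B': "s \<in> horn_lune (norm y) (norm x) 1 \<longleftrightarrow>
   norm s < 1 \<and> Horn_G1_region (x / (1 - s)) (y * (1 - s))"
  by (simp add: horn_lune_def Horn_G1_region_def norm_divide norm_mult add.commute)

lemma Horn_G1_summation_A:
  fixes A B B' :: "complex^'d^'d"
  assumes BB': "mpoch_defined B" "mpoch_defined B'" and t: "norm t < 1"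
    and reg: "Horn_G1_region x y" "Horn_G1_region (x / (1 - t)) (y / (1 - t))"
  defines "F \<equiv> \<lambda>n. cscale (t ^ n / fact n) (mpoch_nat A n ** Horn_G1 (A + mat (of_nat n)) B B' x y)"
  shows "summable F \<Longrightarrow>
      one_minus_mpow_neg t A ** Horn_G1 A B B' (x / (1 - t)) (y / (1 - t)) = (\<Sum>n. F n)"
    and "(\<And>s. norm s \<le> norm t \<Longrightarrow> Horn_G1_region (x / (1 - s)) (y / (1 - s))) \<Longrightarrow> summable F"
proof -
  let ?U = "horn_lune 0 (norm x + norm y) 1"
  let ?H = "\<lambda>s. one_minus_mpow_neg s A ** Horn_G1 A B B' (x / (1 - s)) (y / (1 - s))"
  let ?W = "\<lambda>n. mpoch_nat A n ** Horn_G1 (A + mat (of_nat n)) B B' x y"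
  obtain \<epsilon> where \<epsilon>: "\<epsilon> > 0" "\<And>s. norm s < \<epsilon> \<Longrightarrow> s \<in> ?U \<Longrightarrow> (\<lambda>k. cscale (s ^ k / fact k) (?W k)) sums ?H s"
    using Horn_G1_shift_A_expansion[OF BB' reg(1), of A] unfolding mem_horn_lune_A by blast
  have sub: "?U \<subseteq> ball 0 1" by (auto simp: horn_lune_def)
  hence ne: "1 - s \<noteq> 0" if "s \<in> ?U" for s using that by auto
  have hol: "(\<lambda>s. ?H s $ i $ j) holomorphic_on ?U" for i j
  proof (rule matrix_mult_holomorphic)
    show "(\<lambda>s. one_minus_mpow_neg s A $ i $ j) holomorphic_on ?U" for i j
      using one_minus_mpow_neg_entry_holomorphic sub by (rule holomorphic_on_subset)
    show "(\<lambda>s. Horn_G1 A B B' (x / (1 - s)) (y / (1 - s)) $ i $ j) holomorphic_on ?U" for i j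
      by (rule Horn_G1_entry_holomorphic[OF BB'])
         (use ne in \<open>auto simp: mem_horn_lune_A intro!: holomorphic_intros open_horn_lune\<close>)
  qed
  have pq: "0 \<le> norm x + norm y" "0 + (norm x + norm y) < 1"
    using reg(1) by (auto simp: Horn_G1_region_def)
  have tU: "t \<in> ?U" using t reg(2) by (simp add: mem_horn_lune_A)
  note core = matrix_power_series_on_horn_lune[OF order_refl pq hol \<epsilon>(1) _ tU]
  show "?H t = (\<Sum>n. F n)" if "summable F"
    unfolding F_def by (rule core(1)[OF \<epsilon>(2)]) (use that in \<open>simp_all add: F_def\<close>)
  show "summable F" if "\<And>s. norm s \<le> norm t \<Longrightarrow> Horn_G1_region (x / (1 - s)) (y / (1 - s))"
    unfolding F_def by (rule core(2)[OF \<epsilon>(2)]) (use that t in \<open>auto simp: mem_horn_lune_A\<close>)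
qed

lemma Horn_G1_summation_B':
  fixes A B B' :: "complex^'d^'d"
  assumes BB': "mpoch_defined B" "\<And>k. mpoch_defined (B' + mat (of_nat k))" and t: "norm t < 1"
    and reg: "Horn_G1_region x y" "Horn_G1_region (x / (1 - t)) (y * (1 - t))"
  defines "F \<equiv> \<lambda>n. cscale (t ^ n / fact n) (Horn_G1 A B (B' + mat (of_nat n)) x y ** mpoch_nat B' n)"
  shows "summable F \<Longrightarrow>
      Horn_G1 A B B' (x / (1 - t)) (y * (1 - t)) ** one_minus_mpow_neg t B' = (\<Sum>n. F n)"
    and "(\<And>s. norm s \<le> norm t \<Longrightarrow> Horn_G1_region (x / (1 - s)) (y * (1 - s))) \<Longrightarrow> summable F"
proof -
  have B': "mpoch_defined B'" using BB'(2)[of 0] by (simp add: mat_def flip: zero_vec_def)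
  let ?U = "horn_lune (norm y) (norm x) 1"
  let ?H = "\<lambda>s. Horn_G1 A B B' (x / (1 - s)) (y * (1 - s)) ** one_minus_mpow_neg s B'"
  let ?W = "\<lambda>n. Horn_G1 A B (B' + mat (of_nat n)) x y ** mpoch_nat B' n"
  obtain \<epsilon> where \<epsilon>: "\<epsilon> > 0" "\<And>s. norm s < \<epsilon> \<Longrightarrow> s \<in> ?U \<Longrightarrow> (\<lambda>k. cscale (s ^ k / fact k) (?W k)) sums ?H s"
    using Horn_G1_shift_B'_expansion[OF BB' reg(1), of A] unfolding mem_horn_lune_B' by blast
  have sub: "?U \<subseteq> ball 0 1" by (auto simp: horn_lune_def)
  hence ne: "1 - s \<noteq> 0" if "s \<in> ?U" for s using that by auto
  have hol: "(\<lambda>s. ?H s $ i $ j) holomorphic_on ?U" for i j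
  proof (rule matrix_mult_holomorphic)
    show "(\<lambda>s. one_minus_mpow_neg s B' $ i $ j) holomorphic_on ?U" for i j
      using one_minus_mpow_neg_entry_holomorphic sub by (rule holomorphic_on_subset)
    show "(\<lambda>s. Horn_G1 A B B' (x / (1 - s)) (y * (1 - s)) $ i $ j) holomorphic_on ?U" for i j
      by (rule Horn_G1_entry_holomorphic[OF BB'(1) B'])
         (use ne in \<open>auto simp: mem_horn_lune_B' intro!: holomorphic_intros open_horn_lune\<close>)
  qed
  have pq: "0 \<le> norm y" "0 \<le> norm x" "norm y + norm x < 1"
    using reg(1) by (auto simp: Horn_G1_region_def)
  have tU: "t \<in> ?U" using t reg(2) by (simp add: mem_horn_lune_B')
  note core = matrix_power_series_on_horn_lune[OF pq hol \<epsilon>(1) _ tU]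
  show "?H t = (\<Sum>n. F n)" if "summable F"
    unfolding F_def by (rule core(1)[OF \<epsilon>(2)]) (use that in \<open>simp_all add: F_def\<close>)
  show "summable F" if "\<And>s. norm s \<le> norm t \<Longrightarrow> Horn_G1_region (x / (1 - s)) (y * (1 - s))"
    unfolding F_def by (rule core(2)[OF \<epsilon>(2)]) (use that t in \<open>auto simp: mem_horn_lune_B'\<close>)
qed

lemma commute_mpoch:
  fixes X M :: "complex^'d^'d"
  assumes "mpoch_defined M" "X ** M = M ** X"
  shows "X ** mpoch M l = mpoch M l ** X"
proof (cases "l \<ge> 0")
  case True
  then obtain n where "l = int n" by (metis nonneg_eq_int)
  thus ?thesis using commute_mpoch_nat[OF assms(2)] by simp
next
  case False
  then obtain p where p: "l = - int p" by (metis int_cases2 of_nat_0_le_iff)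
  have "X ** (M + mat (- of_nat p)) = (M + mat (- of_nat p)) ** X"
    by (rule commute_shift[OF assms(2)])
  moreover have "M + mat (- of_nat p) = M - mat (of_nat p)" by (simp add: vec_eq_iff mat_def)
  ultimately have "X ** (M - mat (of_nat p)) = (M - mat (of_nat p)) ** X" by (simp only:)
  hence "X ** mpoch_nat (M - mat (of_nat p)) p = mpoch_nat (M - mat (of_nat p)) p ** X"
    by (rule commute_mpoch_nat)
  thus ?thesis
    unfolding p mpoch_neg(2)[OF assms(1)] by (rule matrix_inv_commute[OF mpoch_neg(1)[OF assms(1)]])
qed

text \<open>
  Exchanging the summation indices exchanges the roles of the two commuting matrices.
\<close>
lemma Horn_G1_swap:
  fixes A B B' :: "complex^'d^'d"
  assumes "B ** B' = B' ** B" "mpoch_defined B" "mpoch_defined B'"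
  shows "Horn_G1 A B B' x y = Horn_G1 A B' B y x"
proof -
  have c: "mpoch B k ** mpoch B' l = mpoch B' l ** mpoch B k" for k l
    using assms by (metis commute_mpoch)
  have "horn_term A B B' x y (m, n) = horn_term A B' B y x (n, m)" for m n
    by (simp add: horn_term_def c add.commute mult.commute flip: matrix_mul_assoc)
  hence swap: "horn_term A B B' x y = (\<lambda>p. horn_term A B' B y x (snd p, fst p))" by auto
  have "bij_betw (\<lambda>p::nat \<times> nat. (snd p, fst p)) UNIV UNIV"
    by (rule bij_betwI[of _ _ _ "\<lambda>p. (snd p, fst p)"]) auto
  thus ?thesis unfolding Horn_G1_eq swap
    by (rule infsum_reindex_bij_betw)
qed

theorem theorem5p1:
  fixes A B B' :: "complex^'d^'d"
  shows
    "(mpoch_defined B \<and> mpoch_defined B' \<longrightarrow>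
       (\<forall>t x y :: complex.
          norm t < 1 \<and> Horn_G1_region x y \<and> Horn_G1_region (x / (1 - t)) (y / (1 - t)) \<longrightarrow>
          (let F = (\<lambda>n. cscale (t ^ n / fact n) (mpoch_nat A n ** Horn_G1 (A + mat (of_nat n)) B B' x y)) in
            (summable F \<longrightarrow>
               one_minus_mpow_neg t A ** Horn_G1 A B B' (x / (1 - t)) (y / (1 - t)) = (\<Sum>n. F n)) \<and>
            ((\<forall>s. norm s \<le> norm t \<longrightarrow> Horn_G1_region (x / (1 - s)) (y / (1 - s))) \<longrightarrow> summable F)))) \<and>
     (B ** B' = B' ** B \<and> (\<forall>k. mpoch_defined (B + mat (of_nat k))) \<and> mpoch_defined B' \<longrightarrow>
       (\<forall>t x y :: complex.
          norm t < 1 \<and> Horn_G1_region x y \<and> Horn_G1_region (x * (1 - t)) (y / (1 - t)) \<longrightarrow>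
          (let F = (\<lambda>n. cscale (t ^ n / fact n) (Horn_G1 A (B + mat (of_nat n)) B' x y ** mpoch_nat B n)) in
            (summable F \<longrightarrow>
               Horn_G1 A B B' (x * (1 - t)) (y / (1 - t)) ** one_minus_mpow_neg t B = (\<Sum>n. F n)) \<and>
            ((\<forall>s. norm s \<le> norm t \<longrightarrow> Horn_G1_region (x * (1 - s)) (y / (1 - s))) \<longrightarrow> summable F)))) \<and>
     (mpoch_defined B \<and> (\<forall>k. mpoch_defined (B' + mat (of_nat k))) \<longrightarrow>
       (\<forall>t x y :: complex.
          norm t < 1 \<and> Horn_G1_region x y \<and> Horn_G1_region (x / (1 - t)) (y * (1 - t)) \<longrightarrow>
          (let F = (\<lambda>n. cscale (t ^ n / fact n) (Horn_G1 A B (B' + mat (of_nat n)) x y ** mpoch_nat B' n)) in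
            (summable F \<longrightarrow>
               Horn_G1 A B B' (x / (1 - t)) (y * (1 - t)) ** one_minus_mpow_neg t B' = (\<Sum>n. F n)) \<and>
            ((\<forall>s. norm s \<le> norm t \<longrightarrow> Horn_G1_region (x / (1 - s)) (y * (1 - s))) \<longrightarrow> summable F))))"
proof (intro conjI impI allI, goal_cases)
  case (1 t x y)
  hence BB': "mpoch_defined B" "mpoch_defined B'" and t: "norm t < 1"
    and reg: "Horn_G1_region x y" "Horn_G1_region (x / (1 - t)) (y / (1 - t))" by auto
  show ?case
    unfolding Let_def using Horn_G1_summation_A[OF BB' t reg, of A] by blast
next
  \<comment> \<open>the formula for \<open>B'\<close>, read with \<open>B\<close>, \<open>B'\<close> and \<open>x\<close>, \<open>y\<close> exchanged\<close>
  case (2 t x y)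
  hence comm: "B ** B' = B' ** B" and BB': "mpoch_defined B'" "\<And>k. mpoch_defined (B + mat (of_nat k))"
    and t: "norm t < 1"
    and reg: "Horn_G1_region y x" "Horn_G1_region (y / (1 - t)) (x * (1 - t))"
    by (auto simp: Horn_G1_region_def add.commute)
  have swap: "Horn_G1 A (B + mat (of_nat n)) B' u v = Horn_G1 A B' (B + mat (of_nat n)) v u" for n u v
    by (rule Horn_G1_swap) (use BB' commute_shift[OF comm[symmetric]] in auto)
  have swap0: "Horn_G1 A B B' u v = Horn_G1 A B' B v u" for u v
    using swap[of 0 u v] by (simp add: mat_def flip: zero_vec_def)
  have sym: "Horn_G1_region (x * (1 - s)) (y / (1 - s)) \<longleftrightarrow> Horn_G1_region (y / (1 - s)) (x * (1 - s))" for s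
    by (simp add: Horn_G1_region_def add.commute)
  show ?case
    unfolding Let_def swap swap0 sym using Horn_G1_summation_B'[OF BB' t reg, of A] by blast
next
  case (3 t x y)
  hence BB': "mpoch_defined B" "\<And>k. mpoch_defined (B' + mat (of_nat k))" and t: "norm t < 1"
    and reg: "Horn_G1_region x y" "Horn_G1_region (x / (1 - t)) (y * (1 - t))" by auto
  show ?case
    unfolding Let_def using Horn_G1_summation_B'[OF BB' t reg, of A] by blast
qed

end
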